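(* If, for some $\alpha\ge 1$, there is an $\alpha$-approximate polynomial Turing kernelization for \textsc{Independent Dominating Set} parameterized by the vertex cover number, then there is a polynomial Turing kernelization for \textsc{CNF-SAT} parameterized by the number $n$ of variables.
   Context: \textsc{Independent Dominating Set}: given a graph $G=(V,E)$, minimize $\lvert X\rvert$ over sets $X\subseteq V$ that are independent and dominating ($N[X]=V$); the parameter is the vertex cover number of $G$. An $\alpha$-approximate Turing kernelization of size $g$ for a parameterized minimization problem is a polynomial-time algorithm that, given an instance $(I,k)$ and an oracle returning in one step a $c$-approximate solution to any instance $(I',k')$ with $\lvert I'\rvert+k'\le g(k)$, outputs a $(c\alpha)$-approximate solution to $(I,k)$, without knowing or depending on $c$; it is polynomial if $g$ is polynomially bounded. \textsc{CNF-SAT}$[n]$: decide satisfiability of a CNF formula, parameter the number of variables. A (polynomial) Turing kernelization of size $g$ for a parameterized decision problem $L$ is a polynomial-time algorithm that, given $(x,k)$ and an oracle deciding in one step membership in $L$ of any $(x',k')$ with $\lvert x'\rvert+k'\le g(k)$, decides whether $(x,k)\in L$; it is polynomial if $g$ is polynomially bounded. *)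

theory Defs
  imports Complex_Main "HOL-Computational_Algebra.Polynomial"
begin

section \<open>Oracle programs and their running time\<close>

text \<open>
  The machine model is the WHILE language on binary trees (N. D. Jones, Computability and Complexity
  from a Programming Perspective, 1997), extended by oracle queries. The size of a value, given by
  the datatype's size function, is its number of \<open>Node\<close>s.
\<close>

datatype data = Leaf | Node data data

datatype exp = Var nat | LeafE | NodeE exp exp | Left exp | Right exp

datatype com =
    Skip
  | Assign nat exp
  | Query nat exp
  | Seq com com
  | If exp com com
  | While exp com

type_synonym state = "nat \<Rightarrow> data"

fun left :: "data \<Rightarrow> data" where
  "left Leaf = Leaf"
| "left (Node a b) = a"

fun right :: "data \<Rightarrow> data" where
  "right Leaf = Leaf"
| "right (Node a b) = b"

fun evalE :: "exp \<Rightarrow> state \<Rightarrow> data" where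
  "evalE (Var x) s = s x"
| "evalE LeafE s = Leaf"
| "evalE (NodeE e1 e2) s = Node (evalE e1 s) (evalE e2 s)"
| "evalE (Left e) s = left (evalE e s)"
| "evalE (Right e) s = right (evalE e s)"

text \<open>
  \<open>exec Or c s t s'\<close>: with oracle \<open>Or\<close>, program \<open>c\<close> started in state \<open>s\<close> halts after time \<open>t\<close> in
  state \<open>s'\<close>. As in Jones's book, trees are thought of as shared pointer structures, so that an
  assignment or a test takes constant time (the expressions in a program are fixed); unit-cost
  programs of this kind and Turing machines simulate each other with polynomial overhead. To keep
  this true in the presence of an oracle, a query is charged for writing down the query in full
  (sharing could otherwise produce exponentially large queries), plus one step for the answer.
\<close>

inductive exec :: "(data \<Rightarrow> data) \<Rightarrow> com \<Rightarrow> state \<Rightarrow> nat \<Rightarrow> state \<Rightarrow> bool" for Or where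
  Skip: "exec Or Skip s 1 s"
| Assign: "exec Or (Assign x e) s 1 (s(x := evalE e s))"
| Query: "exec Or (Query x e) s (size (evalE e s) + 1) (s(x := Or (evalE e s)))"
| Seq: "exec Or c1 s1 t1 s2 \<Longrightarrow> exec Or c2 s2 t2 s3 \<Longrightarrow> exec Or (Seq c1 c2) s1 (t1 + t2) s3"
| IfTrue: "evalE e s \<noteq> Leaf \<Longrightarrow> exec Or c1 s t s' \<Longrightarrow> exec Or (If e c1 c2) s (t + 1) s'"
| IfFalse: "evalE e s = Leaf \<Longrightarrow> exec Or c2 s t s' \<Longrightarrow> exec Or (If e c1 c2) s (t + 1) s'"
| WhileFalse: "evalE e s = Leaf \<Longrightarrow> exec Or (While e c) s 1 s"
| WhileTrue: "evalE e s1 \<noteq> Leaf \<Longrightarrow> exec Or c s1 t1 s2 \<Longrightarrow> exec Or (While e c) s2 t2 s3 \<Longrightarrow>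
    exec Or (While e c) s1 (t1 + t2 + 1) s3"

text \<open>
  Input and output are in variable 0, all other variables are initially \<open>Leaf\<close>. The time includes
  writing the output in full, again because of sharing.
\<close>

definition computes :: "(data \<Rightarrow> data) \<Rightarrow> com \<Rightarrow> data \<Rightarrow> nat \<Rightarrow> data \<Rightarrow> bool" where
  "computes Or c x t y \<longleftrightarrow>
    (\<exists>t' s. exec Or c ((\<lambda>_. Leaf)(0 := x)) t' s \<and> y = s 0 \<and> t = t' + size y)"


section \<open>Encodings\<close>

primrec nat_code :: "nat \<Rightarrow> data" where
  "nat_code 0 = Leaf"
| "nat_code (Suc n) = Node Leaf (nat_code n)"

definition bool_code :: "bool \<Rightarrow> data" where
  "bool_code b = (if b then Node Leaf Leaf else Leaf)"

primrec list_code :: "data list \<Rightarrow> data" where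
  "list_code [] = Leaf"
| "list_code (x # xs) = Node x (list_code xs)"

text \<open>An instance \<open>(x, k)\<close>, as presented to an algorithm or to an oracle.\<close>

definition input_code :: "data \<Rightarrow> nat \<Rightarrow> data" where
  "input_code x k = Node x (nat_code k)"


section \<open>Turing kernelizations\<close>

definition poly_bounded :: "(nat \<Rightarrow> nat) \<Rightarrow> bool" where
  "poly_bounded g \<longleftrightarrow> (\<exists>p :: nat poly. \<forall>n. g n \<le> poly p n)"

text \<open>
  Decision problems are sets of pairs \<open>(x, k)\<close> of an input and a parameter value. The answers of the
  oracle to queries exceeding the size bound are arbitrary.
\<close>

definition decision_oracle :: "(data \<times> nat) set \<Rightarrow> nat \<Rightarrow> (data \<Rightarrow> data) \<Rightarrow> bool" where
  "decision_oracle L b Or \<longleftrightarrow>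
    (\<forall>x k. size x + k \<le> b \<longrightarrow> Or (input_code x k) = bool_code ((x, k) \<in> L))"

definition turing_kernelization :: "(data \<times> nat) set \<Rightarrow> (nat \<Rightarrow> nat) \<Rightarrow> com \<Rightarrow> bool" where
  "turing_kernelization L g c \<longleftrightarrow>
    (\<exists>p :: nat poly. \<forall>x k Or. decision_oracle L (g k) Or \<longrightarrow>
      (\<exists>t \<le> poly p (size x + k). computes Or c (input_code x k) t (bool_code ((x, k) \<in> L))))"

definition has_polynomial_turing_kernelization :: "(data \<times> nat) set \<Rightarrow> bool" where
  "has_polynomial_turing_kernelization L \<longleftrightarrow> (\<exists>g c. poly_bounded g \<and> turing_kernelization L g c)"

text \<open>
  Parameterized minimization problems with instances in \<open>'i\<close> and solutions in \<open>'s\<close>. An instance may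
  have several codes (different orders of listing its elements), and likewise a solution.
\<close>

record ('i, 's) min_problem =
  is_instance :: "'i \<Rightarrow> bool"
  parameter :: "'i \<Rightarrow> nat"
  feasible :: "'i \<Rightarrow> 's \<Rightarrow> bool"
  cost :: "'i \<Rightarrow> 's \<Rightarrow> real"
  codes_instance :: "data \<Rightarrow> 'i \<Rightarrow> bool"
  codes_solution :: "data \<Rightarrow> 's \<Rightarrow> bool"

definition opt :: "('i, 's) min_problem \<Rightarrow> 'i \<Rightarrow> real" where
  "opt P I = Inf (cost P I ` {S. feasible P I S})"

definition approx_solution :: "('i, 's) min_problem \<Rightarrow> real \<Rightarrow> 'i \<Rightarrow> data \<Rightarrow> bool" where
  "approx_solution P c I y \<longleftrightarrow>
    (\<exists>S. codes_solution P y S \<and> feasible P I S \<and> cost P I S \<le> c * opt P I)"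

text \<open>
  The answers to queries that exceed the size bound, or that are not of the form (instance,
  parameter value of this instance), are arbitrary.
\<close>

definition approx_oracle ::
  "('i, 's) min_problem \<Rightarrow> real \<Rightarrow> nat \<Rightarrow> (data \<Rightarrow> data) \<Rightarrow> bool" where
  "approx_oracle P c b Or \<longleftrightarrow>
    (\<forall>I x. is_instance P I \<and> codes_instance P x I \<and> size x + parameter P I \<le> b \<longrightarrow>
      approx_solution P c I (Or (input_code x (parameter P I))))"

text \<open>The program and its time bound are chosen before, hence do not depend on, the ratio \<open>c\<close>.\<close>

definition approx_turing_kernelization ::
  "real \<Rightarrow> ('i, 's) min_problem \<Rightarrow> (nat \<Rightarrow> nat) \<Rightarrow> com \<Rightarrow> bool" where
  "approx_turing_kernelization \<alpha> P g prog \<longleftrightarrow>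
    (\<exists>p :: nat poly. \<forall>c I x Or.
      c \<ge> 1 \<and> is_instance P I \<and> codes_instance P x I \<and> approx_oracle P c (g (parameter P I)) Or \<longrightarrow>
      (\<exists>t y. t \<le> poly p (size x + parameter P I) \<and>
        computes Or prog (input_code x (parameter P I)) t y \<and> approx_solution P (c * \<alpha>) I y))"

definition has_polynomial_approx_turing_kernelization ::
  "real \<Rightarrow> ('i, 's) min_problem \<Rightarrow> bool" where
  "has_polynomial_approx_turing_kernelization \<alpha> P \<longleftrightarrow>
    (\<exists>g prog. poly_bounded g \<and> approx_turing_kernelization \<alpha> P g prog)"


section \<open>Independent Dominating Set parameterized by the vertex cover number\<close>

type_synonym graph = "nat set \<times> nat set set"

definition simple_graph :: "graph \<Rightarrow> bool" where
  "simple_graph G \<longleftrightarrow> (case G of (V, E) \<Rightarrow>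
    finite V \<and> (\<forall>e\<in>E. \<exists>u v. e = {u, v} \<and> u \<noteq> v \<and> u \<in> V \<and> v \<in> V))"

definition vertex_cover :: "graph \<Rightarrow> nat set \<Rightarrow> bool" where
  "vertex_cover G X \<longleftrightarrow> (case G of (V, E) \<Rightarrow> X \<subseteq> V \<and> (\<forall>e\<in>E. e \<inter> X \<noteq> {}))"

definition vertex_cover_number :: "graph \<Rightarrow> nat" where
  "vertex_cover_number G = Min (card ` {X. vertex_cover G X})"

definition closed_neighborhood :: "graph \<Rightarrow> nat set \<Rightarrow> nat set" where
  "closed_neighborhood G X = (case G of (V, E) \<Rightarrow> X \<union> {v \<in> V. \<exists>u\<in>X. {u, v} \<in> E})"

definition independent_dominating_set :: "graph \<Rightarrow> nat set \<Rightarrow> bool" where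
  "independent_dominating_set G X \<longleftrightarrow> (case G of (V, E) \<Rightarrow>
    X \<subseteq> V \<and> (\<forall>u\<in>X. \<forall>v\<in>X. {u, v} \<notin> E) \<and> closed_neighborhood G X = V)"

definition codes_vertex_set :: "data \<Rightarrow> nat set \<Rightarrow> bool" where
  "codes_vertex_set d X \<longleftrightarrow>
    (\<exists>vs. distinct vs \<and> set vs = X \<and> d = list_code (map nat_code vs))"

definition codes_edge_set :: "data \<Rightarrow> nat set set \<Rightarrow> bool" where
  "codes_edge_set d E \<longleftrightarrow>
    (\<exists>es. distinct (map (\<lambda>(u, v). {u, v}) es) \<and> set (map (\<lambda>(u, v). {u, v}) es) = E \<and>
      d = list_code (map (\<lambda>(u, v). Node (nat_code u) (nat_code v)) es))"

definition codes_graph :: "data \<Rightarrow> graph \<Rightarrow> bool" where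
  "codes_graph d G \<longleftrightarrow> (case G of (V, E) \<Rightarrow>
    \<exists>dV dE. d = Node dV dE \<and> codes_vertex_set dV V \<and> codes_edge_set dE E)"

definition IDS_vc :: "(graph, nat set) min_problem" where
  "IDS_vc = \<lparr> is_instance = simple_graph, parameter = vertex_cover_number,
    feasible = independent_dominating_set, cost = (\<lambda>G X. real (card X)),
    codes_instance = codes_graph, codes_solution = codes_vertex_set \<rparr>"


section \<open>CNF-SAT parameterized by the number of variables\<close>

text \<open>The literal \<open>(v, b)\<close> is the variable \<open>v\<close> if \<open>b\<close> holds, and the negation of \<open>v\<close> otherwise.\<close>

type_synonym cnf = "(nat \<times> bool) list list"

definition variables :: "cnf \<Rightarrow> nat set" where
  "variables \<phi> = {v. \<exists>C\<in>set \<phi>. \<exists>b. (v, b) \<in> set C}"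

definition satisfiable :: "cnf \<Rightarrow> bool" where
  "satisfiable \<phi> \<longleftrightarrow> (\<exists>a :: nat \<Rightarrow> bool. \<forall>C\<in>set \<phi>. \<exists>(v, b)\<in>set C. a v = b)"

definition cnf_code :: "cnf \<Rightarrow> data" where
  "cnf_code \<phi> =
    list_code (map (\<lambda>C. list_code (map (\<lambda>(v, b). Node (nat_code v) (bool_code b)) C)) \<phi>)"

definition CNF_SAT_n :: "(data \<times> nat) set" where
  "CNF_SAT_n = {(cnf_code \<phi>, card (variables \<phi>)) | \<phi>. satisfiable \<phi>}"

end

theory Submission
  imports Defs
begin

text \<open>
  The bound on the running time of an approximate kernelization is uniform in the ratio \<open>c\<close> of the
  oracle, and \<open>c\<close> may grow with the instance. An instance of size at most \<open>b\<close> has a solution of cost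
  at most \<open>b\<close>, and its optimum is at least 1 unless the graph is empty, so that every independent
  dominating set is a \<open>b\<close>-approximate solution. Hence greedily computed maximal independent sets are
  correct oracle answers with \<open>c\<close> about \<open>g (2 * n)\<close>, and no oracle is needed at all.

  A formula with \<open>n\<close> variables becomes a graph on its \<open>2 * n\<close> literals, with an edge between \<open>v\<close> and
  its negation, and with \<open>T\<close> vertices for every clause, each adjacent to the literals of the clause.
  The literals form a vertex cover, so the parameter does not depend on \<open>T\<close>. An independent
  dominating set that contains one copy of a clause avoids the literals of this clause and hence
  contains all \<open>T\<close> copies; if it contains none, its literals satisfy the formula. Therefore the minimum
  is at most \<open>2 * n\<close> or at least \<open>T\<close>, and a polynomially large \<open>T > 2 * n * c * \<alpha>\<close> lets the approximate
  solution decide satisfiability in polynomial time.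
\<close>


section \<open>Polynomial bounds\<close>

text \<open>Natural coefficients leave no room for cancellation.\<close>

lemma poly_nat_mono: "mono (poly (p :: nat poly))"
  by (rule monoI, induction p) (auto intro!: add_mono mult_mono)

lemmas poly_nat_monoD = monoD[OF poly_nat_mono]

lemma poly_bounded_const [intro!]: "poly_bounded (\<lambda>_. c)"
  unfolding poly_bounded_def by (rule exI[of _ "[:c:]"]) simp

lemma poly_bounded_id [intro!]: "poly_bounded (\<lambda>n. n)"
  unfolding poly_bounded_def by (rule exI[of _ "[:0, 1:]"]) simp

lemma poly_bounded_add [intro!]:
  assumes "poly_bounded f" "poly_bounded g"
  shows "poly_bounded (\<lambda>n. f n + g n)"
proof -
  from assms obtain p q where "\<And>n. f n \<le> poly p n" "\<And>n. g n \<le> poly q n"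
    by (auto simp: poly_bounded_def)
  then have "f n + g n \<le> poly (p + q) n" for n by (simp add: add_mono)
  then show ?thesis unfolding poly_bounded_def by blast
qed

lemma poly_bounded_mult [intro!]:
  assumes "poly_bounded f" "poly_bounded g"
  shows "poly_bounded (\<lambda>n. f n * g n)"
proof -
  from assms obtain p q where "\<And>n. f n \<le> poly p n" "\<And>n. g n \<le> poly q n"
    by (auto simp: poly_bounded_def)
  then have "f n * g n \<le> poly (p * q) n" for n by (simp add: mult_mono)
  then show ?thesis unfolding poly_bounded_def by blast
qed

lemma poly_bounded_poly [intro!]:
  assumes "poly_bounded f"
  shows "poly_bounded (\<lambda>n. poly p (f n))"
proof -
  from assms obtain q where "\<And>n. f n \<le> poly q n" by (auto simp: poly_bounded_def)
  then have "poly p (f n) \<le> poly (p \<circ>\<^sub>p q) n" for n by (simp add: poly_pcompose poly_nat_monoD)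
  then show ?thesis unfolding poly_bounded_def by blast
qed

lemma poly_bounded_Suc [intro!]: "poly_bounded f \<Longrightarrow> poly_bounded (\<lambda>n. Suc (f n))"
  using poly_bounded_add[of f "\<lambda>_. 1"] by auto


section \<open>Polynomial-time functions\<close>

text \<open>Execution within a time budget instead of an exact time, so that budgets can be weakened
  before programs are composed.\<close>

definition runs :: "(data \<Rightarrow> data) \<Rightarrow> com \<Rightarrow> state \<Rightarrow> nat \<Rightarrow> state \<Rightarrow> bool" where
  "runs Or c s B s' \<longleftrightarrow> (\<exists>t\<le>B. exec Or c s t s')"

lemma runs_mono: "runs Or c s B s' \<Longrightarrow> B \<le> B' \<Longrightarrow> runs Or c s B' s'"
  unfolding runs_def by (meson le_trans)

lemma runs_Skip: "runs Or Skip s 1 s"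
  unfolding runs_def using exec.Skip by blast

lemma runs_Assign: "runs Or (Assign x e) s 1 (s(x := evalE e s))"
  unfolding runs_def using exec.Assign by blast

lemma runs_Seq: "runs Or c1 s1 B1 s2 \<Longrightarrow> runs Or c2 s2 B2 s3 \<Longrightarrow> runs Or (Seq c1 c2) s1 (B1 + B2) s3"
  unfolding runs_def by (meson add_mono exec.Seq)

lemma runs_IfTrue: "evalE e s \<noteq> Leaf \<Longrightarrow> runs Or c1 s B s' \<Longrightarrow> runs Or (If e c1 c2) s (B + 1) s'"
  unfolding runs_def by (meson add_le_mono1 exec.IfTrue)

lemma runs_IfFalse: "evalE e s = Leaf \<Longrightarrow> runs Or c2 s B s' \<Longrightarrow> runs Or (If e c1 c2) s (B + 1) s'"
  unfolding runs_def by (meson add_le_mono1 exec.IfFalse)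

lemma runs_WhileFalse: "evalE e s = Leaf \<Longrightarrow> runs Or (While e c) s 1 s"
  unfolding runs_def using exec.WhileFalse by blast

lemma runs_WhileTrue:
  "evalE e s1 \<noteq> Leaf \<Longrightarrow> runs Or c s1 B1 s2 \<Longrightarrow> runs Or (While e c) s2 B2 s3 \<Longrightarrow>
    runs Or (While e c) s1 (B1 + B2 + 1) s3"
  unfolding runs_def by (meson add_mono exec.WhileTrue add_le_mono1)

section \<open>Encodings of types as trees\<close>

class coded =
  fixes enc :: "'a \<Rightarrow> data"

instantiation data :: coded begin
definition [simp]: "enc (d :: data) = d"
instance ..
end

instantiation nat :: coded begin
definition [simp]: "enc (n :: nat) = nat_code n"
instance ..
end

instantiation bool :: coded begin
definition [simp]: "enc (b :: bool) = bool_code b"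
instance ..
end

instantiation prod :: (coded, coded) coded begin
definition [simp]: "enc p = Node (enc (fst p)) (enc (snd p))"
instance ..
end

instantiation list :: (coded) coded begin
definition "enc xs = list_code (map enc xs)"
instance ..
end

lemma enc_Nil [simp]: "enc [] = Leaf"
  and enc_Cons [simp]: "enc (x # xs) = Node (enc x) (enc xs)"
  by (simp_all add: enc_list_def)

lemma size_nat_code [simp]: "size (nat_code n) = n"
  by (induction n) auto

lemma size_bool_code: "size (bool_code b) \<le> 1"
  by (simp add: bool_code_def)

lemma size_enc_append [simp]: "size (enc (xs @ ys)) = size (enc xs) + size (enc ys)"
  by (induction xs) auto

lemma length_le_size_enc: "length xs \<le> size (enc xs)"
  by (induction xs) auto

lemma size_enc_member: "y \<in> set xs \<Longrightarrow> size (enc y) \<le> size (enc xs)"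
  by (induction xs) auto

text \<open>
  The base \<open>b\<close> makes programs composable: intermediate results are kept below the base of the
  programs that run next. Nothing is assumed about the initial values of the variables above \<open>b\<close>.
\<close>

definition implements :: "nat \<Rightarrow> com \<Rightarrow> (nat \<Rightarrow> nat) \<Rightarrow> ('a::coded \<Rightarrow> 'b::coded) \<Rightarrow> bool" where
  "implements b c T f \<longleftrightarrow> (\<forall>Or s a. s b = enc a \<longrightarrow>
    (\<exists>s'. runs Or c s (T (size (enc a))) s' \<and> s' b = enc (f a) \<and> (\<forall>i<b. s' i = s i)))"

text \<open>The size of the result needs a bound of its own: with sharing, a short run can build an
  exponentially large tree. The polynomial is chosen before the base \<open>b\<close>, and
  \<open>implements\<close> quantifies over all oracles, so the result does not depend on the
  oracle.\<close>

definition polytime :: "('a::coded \<Rightarrow> 'b::coded) \<Rightarrow> bool" where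
  "polytime f \<longleftrightarrow> (\<exists>p. (\<forall>a. size (enc (f a)) \<le> poly p (size (enc a))) \<and>
    (\<forall>b. \<exists>c. implements b c (poly p) f))"

lemma polytimeE:
  assumes "polytime f"
  obtains p where "\<And>a. size (enc (f a)) \<le> poly p (size (enc a))"
    and "\<And>b. \<exists>c. implements b c (poly p) f"
  using assms unfolding polytime_def by blast

lemma implementsE:
  assumes "implements b c T f" "s b = enc a"
  obtains s' where "runs Or c s (T (size (enc a))) s'" "s' b = enc (f a)" "\<And>i. i < b \<Longrightarrow> s' i = s i"
  using assms unfolding implements_def by blast

lemma implements_mono: "implements b c T f \<Longrightarrow> (\<And>n. T n \<le> T' n) \<Longrightarrow> implements b c T' f"
  unfolding implements_def by (meson runs_mono)

lemma polytimeI: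
  assumes "poly_bounded S" "\<And>a. size (enc (f a)) \<le> S (size (enc a))"
    and "poly_bounded T" "\<And>b. \<exists>c. implements b c T f"
  shows "polytime f"
proof -
  from assms(1,3) obtain p q where pq: "\<And>n. S n \<le> poly p n" "\<And>n. T n \<le> poly q n"
    by (auto simp: poly_bounded_def)
  have "size (enc (f a)) \<le> poly (p + q) (size (enc a))" for a
    using assms(2)[of a] pq(1) by (simp, meson le_trans trans_le_add1)
  moreover have "T n \<le> poly (p + q) n" for n
    using pq(2)[of n] by simp
  then have "\<exists>c. implements b c (poly (p + q)) f" for b
    using assms(4)[of b] implements_mono by blast
  ultimately show ?thesis unfolding polytime_def by blast
qed

text \<open>A mere change of the type in which the same tree is read is free. This covers
  \<open>Cons\<close>, \<open>datalist\<close> and the conversion of numbers into lists.\<close>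

lemma polytime_recode:
  assumes "\<And>a. enc (f a) = enc a"
  shows "polytime f"
proof (rule polytimeI)
  show "\<exists>c. implements b c (\<lambda>_. 1) f" for b
    unfolding implements_def using runs_Skip assms by fastforce
  show "size (enc (f a)) \<le> size (enc a)" for a using assms by simp
qed auto

section \<open>Closure of polynomial time under basic constructions\<close>

named_theorems polytime_intros

lemma polytime_id [polytime_intros]: "polytime (\<lambda>x. x)"
  by (rule polytime_recode) simp

lemma polytime_comp:
  assumes "polytime f" "polytime g"
  shows "polytime (\<lambda>x. f (g x))"
proof -
  from assms(1) obtain p where p: "\<And>a. size (enc (f a)) \<le> poly p (size (enc a))"
    "\<And>b. \<exists>c. implements b c (poly p) f" by (rule polytimeE) blast
  from assms(2) obtain q where q: "\<And>a. size (enc (g a)) \<le> poly q (size (enc a))"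
    "\<And>b. \<exists>c. implements b c (poly q) g" by (rule polytimeE) blast
  have pq: "poly p (size (enc (g a))) \<le> poly p (poly q (size (enc a)))" for a
    using q(1) by (rule poly_nat_monoD)
  show ?thesis
  proof (rule polytimeI)
    show "poly_bounded (\<lambda>n. poly p (poly q n))" by auto
    show "size (enc (f (g a))) \<le> poly p (poly q (size (enc a)))" for a
      using p(1) pq le_trans by blast
    show "poly_bounded (\<lambda>n. poly q n + poly p (poly q n))" by auto
    fix b
    obtain c d where c: "implements b c (poly p) f" and d: "implements b d (poly q) g"
      using p(2) q(2) by blast
    have "implements b (Seq d c) (\<lambda>n. poly q n + poly p (poly q n)) (\<lambda>x. f (g x))"
      unfolding implements_def
    proof (intro allI impI)
      fix Or s and a :: 'c assume s: "s b = enc a"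
      obtain s1 where s1: "runs Or d s (poly q (size (enc a))) s1" "s1 b = enc (g a)"
        "\<And>i. i < b \<Longrightarrow> s1 i = s i" using implementsE[of b d "poly q" g s a, OF d s] by blast
      obtain s2 where s2: "runs Or c s1 (poly p (size (enc (g a)))) s2" "s2 b = enc (f (g a))"
        "\<And>i. i < b \<Longrightarrow> s2 i = s1 i" using implementsE[of b c "poly p" f s1 "g a", OF c s1(2)] by blast
      show "\<exists>s'. runs Or (Seq d c) s (poly q (size (enc a)) + poly p (poly q (size (enc a)))) s' \<and>
          s' b = enc (f (g a)) \<and> (\<forall>i<b. s' i = s i)"
        using runs_Seq[OF s1(1) runs_mono[OF s2(1) pq]] s1 s2 by auto
    qed
    then show "\<exists>c. implements b c (\<lambda>n. poly q n + poly p (poly q n)) (\<lambda>x. f (g x))" by blast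
  qed
qed

lemma polytime_Pair [polytime_intros]:
  assumes "polytime f" "polytime g"
  shows "polytime (\<lambda>x. (f x, g x))"
proof -
  from assms(1) obtain p where p: "\<And>a. size (enc (f a)) \<le> poly p (size (enc a))"
    "\<And>b. \<exists>c. implements b c (poly p) f" by (rule polytimeE) blast
  from assms(2) obtain q where q: "\<And>a. size (enc (g a)) \<le> poly q (size (enc a))"
    "\<And>b. \<exists>c. implements b c (poly q) g" by (rule polytimeE) blast
  show ?thesis
  proof (rule polytimeI)
    show "poly_bounded (\<lambda>n. Suc (poly p n + poly q n))" by auto
    show "size (enc (f a, g a)) \<le> Suc (poly p (size (enc a)) + poly q (size (enc a)))" for a
      using p(1)[of a] q(1)[of a] by simp
    let ?T = "\<lambda>n. 1 + (poly p n + (1 + (poly q n + 1)))"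
    show "poly_bounded ?T" by auto
    fix b
    obtain c d where c: "implements (b + 1) c (poly p) f" and d: "implements (b + 2) d (poly q) g"
      using p(2) q(2) by blast
    \<comment> \<open>\<open>f\<close> runs at base \<open>b + 1\<close>, so the argument in
      \<open>b\<close> survives; \<open>g\<close> runs at base \<open>b + 2\<close>, so the result
      of \<open>f\<close> in \<open>b + 1\<close> survives as well.\<close>
    have "implements b (Seq (Assign (b + 1) (Var b)) (Seq c (Seq (Assign (b + 2) (Var b))
       (Seq d (Assign b (NodeE (Var (b + 1)) (Var (b + 2)))))))) ?T (\<lambda>x. (f x, g x))" 
      unfolding implements_def
    proof (intro allI impI)
      fix Or s and a :: 'a assume s: "s b = enc a"
      let ?s1 = "s(b + 1 := enc a)"
      have 1: "runs Or (Assign (b + 1) (Var b)) s 1 ?s1"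
        using runs_Assign[of Or "b + 1" "Var b" s] s by simp
      obtain s2 where s2: "runs Or c ?s1 (poly p (size (enc a))) s2" "s2 (b + 1) = enc (f a)"
        "\<And>i. i < b + 1 \<Longrightarrow> s2 i = ?s1 i" using implementsE[OF c, of ?s1 a] by auto
      let ?s3 = "s2(b + 2 := enc a)"
      have 3: "runs Or (Assign (b + 2) (Var b)) s2 1 ?s3"
        using runs_Assign[of Or "b + 2" "Var b" s2] s s2(3)[of b] by simp
      obtain s4 where s4: "runs Or d ?s3 (poly q (size (enc a))) s4" "s4 (b + 2) = enc (g a)"
        "\<And>i. i < b + 2 \<Longrightarrow> s4 i = ?s3 i" using implementsE[OF d, of ?s3 a] by auto
      have 5: "runs Or (Assign b (NodeE (Var (b + 1)) (Var (b + 2)))) s4 1 (s4(b := enc (f a, g a)))"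
        using runs_Assign[of Or b "NodeE (Var (b + 1)) (Var (b + 2))" s4] s4(2) s4(3)[of "b + 1"] s2(2)
        by simp
      show "\<exists>s'. runs Or (Seq (Assign (b + 1) (Var b)) (Seq c (Seq (Assign (b + 2) (Var b))
          (Seq d (Assign b (NodeE (Var (b + 1)) (Var (b + 2)))))))) s (?T (size (enc a))) s' \<and>
          s' b = enc (f a, g a) \<and> (\<forall>i<b. s' i = s i)"
        by (rule exI, intro conjI, rule runs_Seq[OF 1 runs_Seq[OF s2(1) runs_Seq[OF 3 runs_Seq[OF s4(1) 5]]]])
          (use s2(3) s4(3) in auto)
    qed
    then show "\<exists>c. implements b c ?T (\<lambda>x. (f x, g x))" by blast
  qed
qed

text \<open>For functions given by a single expression, such as projections, successor, predecessor
  and constants. The additive size bound is all that these need.\<close>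

lemma polytime_evalE:
  assumes "\<And>b s a. s b = enc a \<Longrightarrow> evalE (e b) s = enc (f a)"
    and "\<And>a. size (enc (f a)) \<le> k + size (enc a)"
  shows "polytime f"
proof (rule polytimeI)
  show "poly_bounded (\<lambda>n. k + n)" "poly_bounded (\<lambda>_. 1)" by auto
  show "size (enc (f a)) \<le> k + size (enc a)" for a by (rule assms)
  fix b
  have "implements b (Assign b (e b)) (\<lambda>_. 1) f"
    unfolding implements_def using runs_Assign assms(1) by fastforce
  then show "\<exists>c. implements b c (\<lambda>_. 1) f" by blast
qed

lemma size_left: "size (left d) \<le> size d" and size_right: "size (right d) \<le> size d"
  by (cases d; simp)+

lemma polytime_fst: "polytime fst"
  by (rule polytime_evalE[of "\<lambda>b. Left (Var b)" _ 0]) (auto simp: size_left size_right)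

lemma polytime_snd: "polytime snd"
  by (rule polytime_evalE[of "\<lambda>b. Right (Var b)" _ 0]) (auto simp: size_left size_right)

lemma polytime_left: "polytime left"
  by (rule polytime_evalE[of "\<lambda>b. Left (Var b)" _ 0]) (auto simp: size_left size_right)

lemma polytime_right: "polytime right"
  by (rule polytime_evalE[of "\<lambda>b. Right (Var b)" _ 0]) (auto simp: size_left size_right)

lemma polytime_Suc: "polytime Suc"
  by (rule polytime_evalE[of "\<lambda>b. NodeE LeafE (Var b)" _ 1]) (auto simp: size_left size_right)

lemma polytime_pred: "polytime (\<lambda>n::nat. n - 1)"
proof (rule polytime_evalE[of "\<lambda>b. Right (Var b)" _ 0])
  \<comment> \<open>The default \<open>right Leaf = Leaf\<close> agrees with the truncated
    \<open>0 - 1 = 0\<close>.\<close>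
  have "right (nat_code n) = nat_code (n - 1)" for n by (cases n) auto
  then show "evalE (Right (Var b)) s = enc (a - 1)" if "s b = enc a" for b s and a :: nat
    using that by simp
qed simp

lemma polytime_const [polytime_intros]: "polytime (\<lambda>x. k)"
proof -
  have "\<exists>e. \<forall>s. evalE e s = d" for d
  proof (induction d)
    case Leaf then show ?case by (auto intro!: exI[of _ LeafE])
  next
    case (Node d1 d2) then show ?case by (metis evalE.simps(3))
  qed
  then obtain e where "\<And>s. evalE e s = enc k" by blast
  then show ?thesis by (intro polytime_evalE[of "\<lambda>_. e" _ "size (enc k)"]) auto
qed

text \<open>Stated with an arbitrary inner function, so that an expression is decomposed from its
  outermost function inwards.\<close>

lemmas [polytime_intros] = polytime_comp[OF polytime_fst] polytime_comp[OF polytime_snd]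
  polytime_comp[OF polytime_left] polytime_comp[OF polytime_right] polytime_comp[OF polytime_Suc]
  polytime_comp[OF polytime_pred]

lemma polytime_Cons [polytime_intros]:
  assumes "polytime f" "polytime g"
  shows "polytime (\<lambda>x. f x # g x)"
proof -
  have "polytime (\<lambda>(y, ys). y # ys)" by (rule polytime_recode) auto
  from polytime_comp[OF this polytime_Pair[OF assms]] show ?thesis by simp
qed

lemma polytime_If [polytime_intros]:
  assumes "polytime P" "polytime f" "polytime g"
  shows "polytime (\<lambda>x. if P x then f x else g x)"
proof -
  from assms(1) obtain r where r: "\<And>a. size (enc (P a)) \<le> poly r (size (enc a))"
    "\<And>b. \<exists>c. implements b c (poly r) P" by (rule polytimeE) blast
  from assms(2) obtain p where p: "\<And>a. size (enc (f a)) \<le> poly p (size (enc a))"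
    "\<And>b. \<exists>c. implements b c (poly p) f" by (rule polytimeE) blast
  from assms(3) obtain q where q: "\<And>a. size (enc (g a)) \<le> poly q (size (enc a))"
    "\<And>b. \<exists>c. implements b c (poly q) g" by (rule polytimeE) blast
  show ?thesis
  proof (rule polytimeI)
    show "poly_bounded (\<lambda>n. poly p n + poly q n)" by auto
    show "size (enc (if P a then f a else g a)) \<le> poly p (size (enc a)) + poly q (size (enc a))" for a
      using p(1)[of a] q(1)[of a] by simp
    let ?T = "\<lambda>n. 1 + (poly r n + ((poly p n + poly q n) + 1))"
    show "poly_bounded ?T" by auto
    fix b
    obtain h c d where h: "implements (b + 1) h (poly r) P" and c: "implements b c (poly p) f"
      and d: "implements b d (poly q) g" using p(2) q(2) r(2) by blast
    have "implements b (Seq (Assign (b + 1) (Var b)) (Seq h (If (Var (b + 1)) c d))) ?T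
        (\<lambda>x. if P x then f x else g x)"
      unfolding implements_def
    proof (intro allI impI)
      fix Or s and a :: 'a assume s: "s b = enc a"
      let ?s1 = "s(b + 1 := enc a)"
      have 1: "runs Or (Assign (b + 1) (Var b)) s 1 ?s1"
        using runs_Assign[of Or "b + 1" "Var b" s] s by simp
      obtain s2 where s2: "runs Or h ?s1 (poly r (size (enc a))) s2" "s2 (b + 1) = enc (P a)"
        "\<And>i. i < b + 1 \<Longrightarrow> s2 i = ?s1 i" using implementsE[OF h, of ?s1 a] by auto
      have s2b: "s2 b = enc a" using s s2(3)[of b] by simp
      obtain s3 where s3: "runs Or (If (Var (b + 1)) c d) s2 (poly p (size (enc a)) + poly q (size (enc a)) + 1) s3"
        "s3 b = enc (if P a then f a else g a)" "\<And>i. i < b \<Longrightarrow> s3 i = s2 i"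
      proof (cases "P a")
        case True
        obtain s3 where s3: "runs Or c s2 (poly p (size (enc a))) s3" "s3 b = enc (f a)"
          "\<And>i. i < b \<Longrightarrow> s3 i = s2 i" using implementsE[of b c "poly p" f s2 a, OF c s2b] by blast
        have "runs Or (If (Var (b + 1)) c d) s2 (poly p (size (enc a)) + 1) s3"
          using s2(2) True by (intro runs_IfTrue s3) (auto simp: bool_code_def)
        from runs_mono[OF this, of "poly p (size (enc a)) + poly q (size (enc a)) + 1"]
        show thesis by (intro that[of s3]) (use s3 True in auto)
      next
        case False
        obtain s3 where s3: "runs Or d s2 (poly q (size (enc a))) s3" "s3 b = enc (g a)"
          "\<And>i. i < b \<Longrightarrow> s3 i = s2 i" using implementsE[of b d "poly q" g s2 a, OF d s2b] by blast
        have "runs Or (If (Var (b + 1)) c d) s2 (poly q (size (enc a)) + 1) s3"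
          using s2(2) False by (intro runs_IfFalse s3) (auto simp: bool_code_def)
        from runs_mono[OF this, of "poly p (size (enc a)) + poly q (size (enc a)) + 1"]
        show thesis by (intro that[of s3]) (use s3 False in auto)
      qed
      show "\<exists>s'. runs Or (Seq (Assign (b + 1) (Var b)) (Seq h (If (Var (b + 1)) c d))) s (?T (size (enc a))) s' \<and>
          s' b = enc (if P a then f a else g a) \<and> (\<forall>i<b. s' i = s i)"
        by (rule exI, intro conjI, rule runs_Seq[OF 1 runs_Seq[OF s2(1) s3(1)]]) (use s2(3) s3 in auto)
    qed
    then show "\<exists>c. implements b c ?T (\<lambda>x. if P x then f x else g x)" by blast
  qed
qed

text \<open>
  Iteration can let values grow exponentially, hence the bound on the intermediate results.
\<close>

lemma polytime_foldl:
  fixes F :: "'a::coded \<Rightarrow> 'c::coded \<Rightarrow> 'b::coded \<Rightarrow> 'c"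
  assumes L: "polytime L" and A: "polytime A"
    and F: "polytime (\<lambda>z. F (fst z) (fst (snd z)) (snd (snd z)))"
    and R: "poly_bounded R"
    and R': "\<And>a l1 l2. L a = l1 @ l2 \<Longrightarrow> size (enc (foldl (F a) (A a) l1)) \<le> R (size (enc a))"
  shows "polytime (\<lambda>x. foldl (F x) (A x) (L x))"
proof -
  from L obtain p where p: "\<And>a. size (enc (L a)) \<le> poly p (size (enc a))"
    "\<And>b. \<exists>c. implements b c (poly p) L" by (rule polytimeE) blast
  from A obtain q where q: "\<And>a. size (enc (A a)) \<le> poly q (size (enc a))"
    "\<And>b. \<exists>c. implements b c (poly q) A" by (rule polytimeE) blast
  from F obtain r where r: "\<And>b. \<exists>c. implements b c (poly r) (\<lambda>z. F (fst z) (fst (snd z)) (snd (snd z)))"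
    by (rule polytimeE) blast
  \<comment> \<open>The cost of one round: \<open>F\<close> on the triple of argument, accumulator
    and list element, whose size is bounded by the inner sum, and 4 for three assignments and the
    loop test.\<close>
  define K where "K n = poly r (n + (R n + poly p n + 1) + 1) + 4" for n
  show ?thesis
  proof (rule polytimeI)
    show "poly_bounded R" by (rule R)
    show "size (enc (foldl (F a) (A a) (L a))) \<le> R (size (enc a))" for a
      using R'[of a "L a" "[]"] by simp
    let ?T = "\<lambda>n. 1 + (poly p n + (1 + (poly q n + ((poly p n * K n + 1) + 1))))"
    show "poly_bounded ?T" unfolding K_def using R by auto
    fix b
    obtain cL cA cF where cL: "implements (b + 1) cL (poly p) L" and cA: "implements (b + 2) cA (poly q) A"
      and cF: "implements (b + 3) cF (poly r) (\<lambda>z. F (fst z) (fst (snd z)) (snd (snd z)))"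
      using p(2) q(2) r by blast
    \<comment> \<open>Cell \<open>b\<close> holds the argument, \<open>b + 1\<close> the remaining
      list, \<open>b + 2\<close> the accumulator; \<open>b + 3\<close> passes the triple to
      \<open>F\<close> and receives its result.\<close>
    define body where "body = Seq (Assign (b + 3) (NodeE (Var b) (NodeE (Var (b + 2)) (Left (Var (b + 1))))))
      (Seq cF (Seq (Assign (b + 2) (Var (b + 3))) (Assign (b + 1) (Right (Var (b + 1))))))"
    define prog where "prog = Seq (Assign (b + 1) (Var b)) (Seq cL (Seq (Assign (b + 2) (Var b)) (Seq cA
      (Seq (While (Var (b + 1)) body) (Assign b (Var (b + 2)))))))"
    \<comment> \<open>In the invariant \<open>l1\<close> is the part already consumed, so the
      accumulator is a fold over a prefix and \<open>R'\<close> bounds it in every round.\<close>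
    have loop: "\<exists>s'. runs Or (While (Var (b + 1)) body) s (length l2 * K (size (enc a)) + 1) s' \<and>
        s' (b + 2) = enc (foldl (F a) (A a) (L a)) \<and> (\<forall>i<b. s' i = s i)"
      if "L a = l1 @ l2" "s b = enc a" "s (b + 1) = enc l2" "s (b + 2) = enc (foldl (F a) (A a) l1)"
      for Or s a l1 l2
      using that
    proof (induction l2 arbitrary: s l1)
      case Nil
      then show ?case using runs_WhileFalse[of "Var (b + 1)" s Or body] by auto
    next
      case (Cons y l2)
      let ?acc = "foldl (F a) (A a) l1"
      let ?z = "(a, ?acc, y)"
      let ?s1 = "s(b + 3 := enc ?z)"
      have 1: "runs Or (Assign (b + 3) (NodeE (Var b) (NodeE (Var (b + 2)) (Left (Var (b + 1)))))) s 1 ?s1"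
        using runs_Assign[of Or "b + 3" "NodeE (Var b) (NodeE (Var (b + 2)) (Left (Var (b + 1))))" s] Cons.prems
        by simp
      obtain s2 where s2: "runs Or cF ?s1 (poly r (size (enc ?z))) s2" "s2 (b + 3) = enc (F a ?acc y)"
        "\<And>i. i < b + 3 \<Longrightarrow> s2 i = ?s1 i" using implementsE[OF cF, of ?s1 ?z] by auto
      let ?s3 = "s2(b + 2 := enc (F a ?acc y))"
      have 3: "runs Or (Assign (b + 2) (Var (b + 3))) s2 1 ?s3"
        using runs_Assign[of Or "b + 2" "Var (b + 3)" s2] s2(2) by simp
      let ?s4 = "?s3(b + 1 := enc l2)"
      have 4: "runs Or (Assign (b + 1) (Right (Var (b + 1)))) ?s3 1 ?s4"
        using runs_Assign[of Or "b + 1" "Right (Var (b + 1))" ?s3] s2(3)[of "b + 1"] Cons.prems by simp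
      have "size (enc y) \<le> poly p (size (enc a))"
        using size_enc_member[of y "L a"] p(1)[of a] Cons.prems(1) by simp
      then have "size (enc ?z) \<le> size (enc a) + (R (size (enc a)) + poly p (size (enc a)) + 1) + 1"
        using R'[of a l1 "y # l2"] Cons.prems(1) by simp
      from poly_nat_monoD[OF this, of r]
      have le: "1 + (poly r (size (enc ?z)) + (1 + 1)) + (length l2 * K (size (enc a)) + 1) + 1
          \<le> length (y # l2) * K (size (enc a)) + 1"
        by (simp add: K_def)
      have pre: "L a = (l1 @ [y]) @ l2" "?s4 b = enc a" "?s4 (b + 1) = enc l2"
        "?s4 (b + 2) = enc (foldl (F a) (A a) (l1 @ [y]))"
        using Cons.prems s2(3)[of b] by auto
      obtain s5 where s5: "runs Or (While (Var (b + 1)) body) ?s4 (length l2 * K (size (enc a)) + 1) s5"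
        "s5 (b + 2) = enc (foldl (F a) (A a) (L a))" "\<And>i. i < b \<Longrightarrow> s5 i = ?s4 i"
        using Cons.IH[OF pre] by blast
      have "runs Or body s (1 + (poly r (size (enc ?z)) + (1 + 1))) ?s4"
        unfolding body_def by (rule runs_Seq[OF 1 runs_Seq[OF s2(1) runs_Seq[OF 3 4]]])
      from runs_mono[OF runs_WhileTrue[OF _ this s5(1)] le] show ?case
        using s5 s2(3) Cons.prems(3) by auto
    qed
    have "implements b prog ?T (\<lambda>x. foldl (F x) (A x) (L x))"
      unfolding implements_def
    proof (intro allI impI)
      fix Or s and a :: 'a assume s: "s b = enc a"
      let ?s1 = "s(b + 1 := enc a)"
      have 1: "runs Or (Assign (b + 1) (Var b)) s 1 ?s1"
        using runs_Assign[of Or "b + 1" "Var b" s] s by simp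
      obtain s2 where s2: "runs Or cL ?s1 (poly p (size (enc a))) s2" "s2 (b + 1) = enc (L a)"
        "\<And>i. i < b + 1 \<Longrightarrow> s2 i = ?s1 i" using implementsE[OF cL, of ?s1 a] by auto
      let ?s3 = "s2(b + 2 := enc a)"
      have 3: "runs Or (Assign (b + 2) (Var b)) s2 1 ?s3"
        using runs_Assign[of Or "b + 2" "Var b" s2] s s2(3)[of b] by simp
      obtain s4 where s4: "runs Or cA ?s3 (poly q (size (enc a))) s4" "s4 (b + 2) = enc (A a)"
        "\<And>i. i < b + 2 \<Longrightarrow> s4 i = ?s3 i" using implementsE[OF cA, of ?s3 a] by auto
      obtain s5 where s5: "runs Or (While (Var (b + 1)) body) s4 (length (L a) * K (size (enc a)) + 1) s5"
        "s5 (b + 2) = enc (foldl (F a) (A a) (L a))" "\<And>i. i < b \<Longrightarrow> s5 i = s4 i"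
        using loop[of a "[]" "L a" s4 Or] s2(2) s2(3)[of b] s4(2) s4(3)[of b] s4(3)[of "b + 1"] s by auto
      have "length (L a) \<le> poly p (size (enc a))"
        using p(1)[of a] length_le_size_enc[of "L a"] by simp
      then have le: "length (L a) * K (size (enc a)) + 1 \<le> poly p (size (enc a)) * K (size (enc a)) + 1"
        by simp
      have 6: "runs Or (Assign b (Var (b + 2))) s5 1 (s5(b := enc (foldl (F a) (A a) (L a))))"
        using runs_Assign[of Or b "Var (b + 2)" s5] s5(2) by simp
      show "\<exists>s'. runs Or prog s (?T (size (enc a))) s' \<and>
          s' b = enc (foldl (F a) (A a) (L a)) \<and> (\<forall>i<b. s' i = s i)"
        unfolding prog_def
        by (rule exI, intro conjI, rule runs_Seq[OF 1 runs_Seq[OF s2(1) runs_Seq[OF 3 runs_Seq[OF s4(1)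
            runs_Seq[OF runs_mono[OF s5(1) le] 6]]]]])
          (use s2(3) s4(3) s5(3) in auto)
    qed
    then show "\<exists>c. implements b c ?T (\<lambda>x. foldl (F x) (A x) (L x))" by blast
  qed
qed

text \<open>If each round adds an amount bounded in terms of the argument alone, growth is linear in
  the number of rounds, and no exponential blow-up can occur.\<close>

lemma polytime_foldl_increment:
  fixes F :: "'a::coded \<Rightarrow> 'c::coded \<Rightarrow> 'b::coded \<Rightarrow> 'c"
  assumes L: "polytime L" and A: "polytime A"
    and F: "polytime (\<lambda>z. F (fst z) (fst (snd z)) (snd (snd z)))"
    and D: "poly_bounded D"
    and D': "\<And>a acc y. y \<in> set (L a) \<Longrightarrow> size (enc (F a acc y)) \<le> size (enc acc) + D (size (enc a))"
  shows "polytime (\<lambda>x. foldl (F x) (A x) (L x))"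
proof -
  from L obtain p where p: "\<And>a. size (enc (L a)) \<le> poly p (size (enc a))" by (rule polytimeE) blast
  from A obtain q where q: "\<And>a. size (enc (A a)) \<le> poly q (size (enc a))" by (rule polytimeE) blast
  show ?thesis
  proof (rule polytime_foldl[OF L A F])
    show "poly_bounded (\<lambda>n. poly q n + poly p n * D n)" using D by auto
    fix a l1 l2 assume l: "L a = l1 @ l2"
    have "size (enc (foldl (F a) (A a) l)) \<le> size (enc (A a)) + length l * D (size (enc a))"
      if "set l \<subseteq> set (L a)" for l
      using that
    proof (induction l rule: rev_induct)
      case (snoc y l)
      then show ?case using D'[of y a "foldl (F a) (A a) l"] by simp
    qed simp
    from this[of l1] have "size (enc (foldl (F a) (A a) l1)) \<le> size (enc (A a)) + length l1 * D (size (enc a))"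
      using l by simp
    also have "length l1 * D (size (enc a)) \<le> poly p (size (enc a)) * D (size (enc a))"
      using length_le_size_enc[of "L a"] p[of a] l by (intro mult_right_mono) auto
    finally show "size (enc (foldl (F a) (A a) l1)) \<le> poly q (size (enc a)) + poly p (size (enc a)) * D (size (enc a))"
      using q[of a] by simp
  qed
qed


section \<open>A library of polynomial-time functions\<close>

text \<open>Every tree codes a list of trees, read along its right spine. Decoding is therefore
  total, and it leaves the underlying tree unchanged.\<close>

fun datalist :: "data \<Rightarrow> data list" where
  "datalist Leaf = []"
| "datalist (Node d e) = d # datalist e"

lemma enc_datalist [simp]: "enc (datalist d) = d"
  by (induction d rule: datalist.induct) auto

lemma datalist_list_code [simp]: "datalist (list_code ds) = ds"
  by (induction ds) auto

definition nat_of :: "data \<Rightarrow> nat" where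
  "nat_of d = length (datalist d)"

lemma nat_of_nat_code [simp]: "nat_of (nat_code n) = n"
  by (induction n) (auto simp: nat_of_def)

text \<open>A unary number and a list of that many leaves are the same tree; this reduces arithmetic
  to list operations.\<close>

lemma enc_replicate_Leaf [simp]: "enc (replicate n Leaf) = nat_code n"
  by (induction n) auto

lemma polytime_datalist [polytime_intros]: "polytime f \<Longrightarrow> polytime (\<lambda>x. datalist (f x))"
  by (rule polytime_comp, rule polytime_recode) simp_all

lemma polytime_replicate_Leaf [polytime_intros]:
  "polytime f \<Longrightarrow> polytime (\<lambda>x. replicate (f x) Leaf)"
  by (rule polytime_comp, rule polytime_recode) simp_all

section \<open>Bounded quantifiers and Boolean connectives\<close>

lemma polytime_Bex [polytime_intros]:
  assumes "polytime L" "polytime (\<lambda>z. P (fst z) (snd z))"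
  shows "polytime (\<lambda>x. \<exists>y\<in>set (L x). P x y)"
proof -
  have eq: "foldl (\<lambda>acc y. if Q y then True else acc) b l \<longleftrightarrow> b \<or> (\<exists>y\<in>set l. Q y)" for Q b and l :: "'b list"
    by (induction l arbitrary: b) auto
  \<comment> \<open>The step of a fold receives argument, accumulator and element; the accumulator
    is projected away.\<close>
  have "polytime (\<lambda>z. P (fst z) (snd (snd z)))"
    using polytime_comp[OF assms(2), of "\<lambda>z. (fst z, snd (snd z))"] by (simp add: polytime_intros)
  then have "polytime (\<lambda>x. foldl (\<lambda>acc y. if P x y then True else acc) False (L x))"
    by (intro polytime_foldl_increment[where D = "\<lambda>_. 1"] polytime_intros assms)
      (auto simp: bool_code_def)
  then show ?thesis by (simp add: eq)
qed

lemma polytime_Not [polytime_intros]: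
  assumes "polytime P" shows "polytime (\<lambda>x. \<not> P x)"
proof -
  have "polytime (\<lambda>x. if P x then False else True)" by (intro polytime_intros assms)
  also have "(\<lambda>x. if P x then False else True) = (\<lambda>x. \<not> P x)" by auto
  finally show ?thesis .
qed

lemma polytime_conj [polytime_intros]:
  assumes "polytime P" "polytime Q" shows "polytime (\<lambda>x. P x \<and> Q x)"
proof -
  have "polytime (\<lambda>x. if P x then Q x else False)" by (intro polytime_intros assms)
  also have "(\<lambda>x. if P x then Q x else False) = (\<lambda>x. P x \<and> Q x)" by auto
  finally show ?thesis .
qed

lemma polytime_disj [polytime_intros]: "polytime P \<Longrightarrow> polytime Q \<Longrightarrow> polytime (\<lambda>x. P x \<or> Q x)"
  using polytime_Not[OF polytime_conj[OF polytime_Not polytime_Not], of P Q] by simp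

lemma polytime_Ball [polytime_intros]:
  assumes "polytime L" "polytime (\<lambda>z. P (fst z) (snd z))"
  shows "polytime (\<lambda>x. \<forall>y\<in>set (L x). P x y)"
  using polytime_Not[OF polytime_Bex[OF assms(1) polytime_Not[OF assms(2)]]] by simp

section \<open>List operations\<close>

lemma polytime_rev [polytime_intros]:
  assumes "polytime f" shows "polytime (\<lambda>x. rev (f x))"
proof (rule polytime_comp[OF _ assms])
  have "polytime (\<lambda>xs::'b list. foldl (\<lambda>acc y. y # acc) [] xs)"
    by (intro polytime_foldl_increment[where D = "\<lambda>n. n + 1"] polytime_intros)
      (auto dest: size_enc_member)
  also have "(\<lambda>xs::'b list. foldl (\<lambda>acc y. y # acc) [] xs) = rev"
    by (simp add: foldl_conv_fold fun_eq_iff fold_Cons_rev)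
  finally show "polytime (rev :: 'b list \<Rightarrow> _)" .
qed

lemma polytime_append [polytime_intros]:
  assumes "polytime f" "polytime g" shows "polytime (\<lambda>x. f x @ g x)"
proof -
  have "polytime (\<lambda>p::'b list \<times> 'b list. foldl (\<lambda>acc y. y # acc) (snd p) (rev (fst p)))"
    by (intro polytime_foldl_increment[where D = "\<lambda>n. n + 1"] polytime_intros poly_bounded_add
        poly_bounded_id poly_bounded_const) (auto dest: size_enc_member)
  from polytime_comp[OF this polytime_Pair[OF assms]] show ?thesis
    by (simp add: foldl_conv_fold fold_Cons_rev)
qed

lemma polytime_concat_map [polytime_intros]:
  assumes L: "polytime L" and F: "polytime (\<lambda>z. F (fst z) (snd z))"
  shows "polytime (\<lambda>x. concat (map (F x) (L x)))"
proof -
  have eq: "foldl (\<lambda>acc y. acc @ f y) b l = b @ concat (map f l)" for f :: "'b \<Rightarrow> 'c list" and b l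
    by (induction l arbitrary: b) auto
  from L obtain p where p: "\<And>a. size (enc (L a)) \<le> poly p (size (enc a))" by (rule polytimeE) blast
  from F obtain q where q: "\<And>z. size (enc (F (fst z) (snd z))) \<le> poly q (size (enc z))"
    by (rule polytimeE) blast
  have F': "polytime (\<lambda>z. F (fst z) (snd (snd z)))"
    using polytime_comp[OF F, of "\<lambda>z. (fst z, snd (snd z))"] by (simp add: polytime_intros)
  have "polytime (\<lambda>x. foldl (\<lambda>acc y. acc @ F x y) [] (L x))"
  proof (intro polytime_foldl_increment[where D = "\<lambda>n. poly q (n + poly p n + 1)"] polytime_intros L F')
    fix a y and acc :: "'c list" assume "y \<in> set (L a)"
    then have "size (enc (a, y)) \<le> size (enc a) + poly p (size (enc a)) + 1"
      using size_enc_member[of y "L a"] p[of a] by simp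
    from poly_nat_monoD[OF this, of q] q[of "(a, y)"]
    show "size (enc (acc @ F a y)) \<le> size (enc acc) + poly q (size (enc a) + poly p (size (enc a)) + 1)"
      by simp
  qed auto
  then show ?thesis by (simp add: eq)
qed

lemma polytime_map [polytime_intros]:
  assumes "polytime L" "polytime (\<lambda>z. F (fst z) (snd z))"
  shows "polytime (\<lambda>x. map (F x) (L x))"
proof -
  have "polytime (\<lambda>x. concat (map (\<lambda>y. [F x y]) (L x)))"
    by (intro polytime_intros assms)
  then show ?thesis by (simp add: concat_map_singleton)
qed

lemma polytime_filter [polytime_intros]:
  assumes "polytime L" "polytime (\<lambda>z. P (fst z) (snd z))"
  shows "polytime (\<lambda>x. filter (P x) (L x))"
proof -
  have eq: "concat (map (\<lambda>y. if P y then [y] else []) l) = filter P l" for P and l :: "'b list"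
    by (induction l) auto
  have "polytime (\<lambda>x. concat (map (\<lambda>y. if P x y then [y] else []) (L x)))"
    by (intro polytime_intros assms)
  then show ?thesis by (simp add: eq)
qed

lemma polytime_length [polytime_intros]:
  assumes "polytime f" shows "polytime (\<lambda>x. length (f x))"
proof (rule polytime_comp[OF _ assms])
  have eq: "foldl (\<lambda>acc _. Suc acc) n l = length l + n" for n and l :: "'b list"
    by (induction l arbitrary: n) auto
  have "polytime (\<lambda>xs::'b list. foldl (\<lambda>acc _. Suc acc) 0 xs)"
    by (intro polytime_foldl_increment[where D = "\<lambda>n. 1"] polytime_intros) auto
  then show "polytime (length :: 'b list \<Rightarrow> _)" by (simp add: eq)
qed

lemma polytime_nat_of [polytime_intros]: "polytime f \<Longrightarrow> polytime (\<lambda>x. nat_of (f x))"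
  unfolding nat_of_def by (intro polytime_intros)

section \<open>Arithmetic and comparison of unary numbers\<close>

lemma polytime_add [polytime_intros]:
  fixes f g :: "'a::coded \<Rightarrow> nat"
  assumes "polytime f" "polytime g" shows "polytime (\<lambda>x. f x + g x)"
proof -
  have "f x + g x = length (replicate (f x) Leaf @ replicate (g x) Leaf)" for x by simp
  then show ?thesis by (simp only:) (intro polytime_intros assms)
qed

lemma polytime_mult [polytime_intros]:
  fixes f g :: "'a::coded \<Rightarrow> nat"
  assumes "polytime f" "polytime g" shows "polytime (\<lambda>x. f x * g x)"
proof -
  have "f x * g x = length (concat (map (\<lambda>_. replicate (g x) Leaf) (replicate (f x) Leaf)))" for x
    by (simp add: length_concat sum_list_replicate)
  moreover have "polytime (\<lambda>z. g (fst z))" using polytime_comp[OF assms(2) polytime_fst] .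
  ultimately show ?thesis by (simp only:) (intro polytime_intros assms)
qed

lemma polytime_diff [polytime_intros]:
  fixes f g :: "'a::coded \<Rightarrow> nat"
  assumes "polytime f" "polytime g" shows "polytime (\<lambda>x. f x - g x)"
proof -
  have eq: "foldl (\<lambda>acc _. acc - 1) n l = n - length l" for n :: nat and l :: "data list"
    by (induction l arbitrary: n) auto
  have "polytime (\<lambda>p::nat \<times> nat. foldl (\<lambda>acc _. acc - 1) (fst p) (replicate (snd p) Leaf))"
    by (intro polytime_foldl_increment[where D = "\<lambda>n. 0"] polytime_intros) auto
  from polytime_comp[OF this polytime_Pair[OF assms]] show ?thesis by (simp only: eq) simp
qed

lemma polytime_le [polytime_intros]:
  fixes f g :: "'a::coded \<Rightarrow> nat"
  assumes "polytime f" "polytime g" shows "polytime (\<lambda>x. f x \<le> g x)"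
proof -
  \<comment> \<open>The truncated difference is 0 exactly if the list of that many leaves has no
    element.\<close>
  have "f x \<le> g x \<longleftrightarrow> \<not> (\<exists>y\<in>set (replicate (f x - g x) Leaf). True)" for x by auto
  then show ?thesis by (simp only:) (intro polytime_intros assms)
qed

lemma polytime_less [polytime_intros]:
  fixes f g :: "'a::coded \<Rightarrow> nat"
  shows "polytime f \<Longrightarrow> polytime g \<Longrightarrow> polytime (\<lambda>x. f x < g x)"
  using polytime_Not[OF polytime_le[of g f]] by (simp add: not_le)

lemma polytime_eq_nat [polytime_intros]:
  fixes f g :: "'a::coded \<Rightarrow> nat"
  assumes "polytime f" "polytime g" shows "polytime (\<lambda>x. f x = g x)"
  unfolding eq_iff[of "f _"] by (intro polytime_intros assms)

lemma polytime_eq_Leaf [polytime_intros]: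
  assumes "polytime f" shows "polytime (\<lambda>x. f x = Leaf)"
proof -
  have "d = Leaf \<longleftrightarrow> nat_of d \<le> 0" for d by (cases d) (auto simp: nat_of_def)
  then show ?thesis by (simp only:) (intro polytime_intros assms)
qed

lemma polytime_poly [polytime_intros]:
  fixes f :: "'a::coded \<Rightarrow> nat"
  assumes "polytime f" shows "polytime (\<lambda>x. poly p (f x))"
proof (induction p)
  case (pCons c p)
  then show ?case by simp (intro polytime_intros assms)
qed (simp add: polytime_intros)

text \<open>The current length of the accumulator serves as the next index, so one pass suffices.
  The reversed order is harmless where the lists code sets.\<close>

lemma rev_enumerate_foldl: "foldl (\<lambda>acc y. (length acc, y) # acc) [] xs = rev (List.enumerate 0 xs)"
  by (induction xs rule: rev_induct) (auto simp: enumerate_append_eq)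

lemma polytime_rev_enumerate [polytime_intros]:
  assumes "polytime f" shows "polytime (\<lambda>x. rev (List.enumerate 0 (f x)))"
proof (rule polytime_comp[OF _ assms])
  have "polytime (\<lambda>xs::'b list. foldl (\<lambda>acc y. (length acc, y) # acc) [] xs)"
  \<comment> \<open>A round adds a unary index that grows with the accumulator, so a quadratic bound
    on the intermediate results is proved directly.\<close>
  proof (rule polytime_foldl)
    show "poly_bounded (\<lambda>n. n * (n + 2) + n)" by (auto simp del: One_nat_def)
    have *: "size (enc (rev (List.enumerate 0 l))) \<le> length l * (length l + 2) + size (enc l)" for l :: "'b list"
      by (induction l rule: rev_induct) (auto simp: enumerate_append_eq algebra_simps)
    fix a l1 l2 :: "'b list" assume a: "a = l1 @ l2"
    have l: "length l1 \<le> size (enc a)" "size (enc l1) \<le> size (enc a)"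
      using length_le_size_enc[of l1] a by auto
    then have "length l1 * (length l1 + 2) \<le> size (enc a) * (size (enc a) + 2)"
      by (intro mult_mono) auto
    with *[of l1] l show "size (enc (foldl (\<lambda>acc y. (length acc, y) # acc) [] l1))
        \<le> size (enc a) * (size (enc a) + 2) + size (enc a)"
      unfolding rev_enumerate_foldl by linarith
  qed (intro polytime_intros)+
  then show "polytime (\<lambda>xs::'b list. rev (List.enumerate 0 xs))" unfolding rev_enumerate_foldl .
qed


section \<open>Parsing formulas\<close>

text \<open>Recognizes exactly the codes of literals: a unary number has only leaves along its
  spine, and a truth value is \<open>Leaf\<close> or \<open>Node Leaf Leaf\<close>. Only tests from
  the library above are used, so that polynomial time follows by decomposition.\<close>

definition valid_literal :: "data \<Rightarrow> bool" where
  "valid_literal d \<longleftrightarrow> \<not> d = Leaf \<and> (\<forall>y\<in>set (datalist (left d)). y = Leaf) \<and>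
    (right d = Leaf \<or> (\<not> right d = Leaf \<and> left (right d) = Leaf \<and> right (right d) = Leaf))"

definition parse_literal :: "data \<Rightarrow> nat \<times> bool" where
  "parse_literal d = (nat_of (left d), \<not> right d = Leaf)"

definition valid_cnf :: "data \<Rightarrow> bool" where
  "valid_cnf d \<longleftrightarrow> (\<forall>C\<in>set (datalist d). \<forall>l\<in>set (datalist C). valid_literal l)"

definition parse_cnf :: "data \<Rightarrow> cnf" where
  "parse_cnf d = map (\<lambda>C. map parse_literal (datalist C)) (datalist d)"

lemma nat_code_nat_of: "\<forall>y\<in>set (datalist d). y = Leaf \<Longrightarrow> nat_code (nat_of d) = d"
  by (induction d rule: datalist.induct) (auto simp: nat_of_def)

lemma enc_parse_literal: "valid_literal d \<Longrightarrow> enc (parse_literal d) = d"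
  by (cases d; cases "right d")
    (auto simp: valid_literal_def parse_literal_def nat_code_nat_of bool_code_def)

lemma cnf_code_eq_enc: "cnf_code \<phi> = enc \<phi>"
  by (auto simp: cnf_code_def enc_list_def fun_eq_iff case_prod_unfold intro!: arg_cong[where f = list_code])

lemma enc_map_eq:
  "(\<And>y. y \<in> set (datalist d) \<Longrightarrow> enc (f y) = y) \<Longrightarrow> enc (map f (datalist d)) = d"
  by (induction d rule: datalist.induct) auto

lemma cnf_code_parse_cnf: "valid_cnf d \<Longrightarrow> cnf_code (parse_cnf d) = d"
  unfolding cnf_code_eq_enc parse_cnf_def valid_cnf_def
  by (intro enc_map_eq enc_parse_literal) auto

lemma parse_literal_enc: "parse_literal (enc l) = l" and valid_literal_enc: "valid_literal (enc l)"
proof -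
  have "y = Leaf" if "y \<in> set (datalist (nat_code n))" for y n
    using that by (induction n) auto
  then show "parse_literal (enc l) = l" "valid_literal (enc l)"
    by (cases l; force simp: parse_literal_def valid_literal_def bool_code_def)+
qed

lemma parse_cnf_code: "parse_cnf (cnf_code \<phi>) = \<phi>" and valid_cnf_code: "valid_cnf (cnf_code \<phi>)"
  unfolding cnf_code_eq_enc parse_cnf_def valid_cnf_def
  using parse_literal_enc[simplified] valid_literal_enc[of "(_, _)", simplified]
  by (auto simp: enc_list_def comp_def)

lemma polytime_parse_cnf [polytime_intros]: "polytime f \<Longrightarrow> polytime (\<lambda>x. parse_cnf (f x))"
  unfolding parse_cnf_def parse_literal_def
  by (intro polytime_intros)

lemma polytime_valid_cnf [polytime_intros]: "polytime f \<Longrightarrow> polytime (\<lambda>x. valid_cnf (f x))"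
  unfolding valid_cnf_def valid_literal_def
  by (intro polytime_intros)


section \<open>The reduction\<close>

text \<open>A left fold with a bounded quantifier as membership test, the shape for which polynomial
  time is available.\<close>

definition distinct_nats :: "nat list \<Rightarrow> nat list" where
  "distinct_nats xs = foldl (\<lambda>acc y. if \<exists>z\<in>set acc. z = y then acc else y # acc) [] xs"

lemma set_distinct_nats [simp]: "set (distinct_nats xs) = set xs"
  by (induction xs rule: rev_induct) (auto simp: distinct_nats_def)

lemma distinct_distinct_nats [simp]: "distinct (distinct_nats xs)"
  by (induction xs rule: rev_induct) (auto simp: distinct_nats_def)

lemma polytime_distinct_nats [polytime_intros]:
  assumes "polytime f" shows "polytime (\<lambda>x. distinct_nats (f x))"
proof (rule polytime_comp[OF _ assms])
  have "polytime (\<lambda>xs. foldl (\<lambda>acc y. if \<exists>z\<in>set acc. z = y then acc else y # acc) [] xs :: nat list)"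
    by (intro polytime_foldl_increment[where D = "\<lambda>n. n + 1"] polytime_intros)
      (auto dest: size_enc_member)
  then show "polytime distinct_nats" unfolding distinct_nats_def .
qed

definition cnf_vars :: "cnf \<Rightarrow> nat list" where
  "cnf_vars \<phi> = distinct_nats (concat (map (\<lambda>C. map fst C) \<phi>))"

lemma set_cnf_vars: "set (cnf_vars \<phi>) = variables \<phi>"
  by (force simp: cnf_vars_def variables_def)

lemma distinct_cnf_vars: "distinct (cnf_vars \<phi>)"
  by (simp add: cnf_vars_def)

lemma polytime_cnf_vars [polytime_intros]: "polytime f \<Longrightarrow> polytime (\<lambda>x. cnf_vars (f x))"
  unfolding cnf_vars_def by (intro polytime_intros)

text \<open>Halving recovers the variable, and parity the sign.\<close>

definition literal_number :: "nat \<times> bool \<Rightarrow> nat" where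
  "literal_number l = (if snd l then Suc (2 * fst l) else 2 * fst l)"

definition literals :: "nat list \<Rightarrow> nat list" where
  "literals vs = concat (map (\<lambda>v. [2 * v, Suc (2 * v)]) vs)"

text \<open>The clause list is repeated as a whole; equal clauses are told apart by their positions,
  which later number the clause vertices.\<close>

definition copies :: "nat \<Rightarrow> cnf \<Rightarrow> nat list list" where
  "copies T \<phi> = concat (map (\<lambda>_. map (\<lambda>C. map literal_number C) \<phi>) (replicate T Leaf))"

text \<open>
  The literal with number \<open>l\<close> is the vertex \<open>3 * l\<close> and has the pendant neighbour \<open>3 * l + 1\<close>.
  The clause at position \<open>q\<close> is the vertex \<open>3 * q + 2\<close>. The pendant vertices are there to make
  the vertex cover number known exactly, since it is part of the input of the kernelization.
\<close>

definition graph_vertices :: "nat list \<Rightarrow> nat list list \<Rightarrow> nat list" where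
  "graph_vertices vs Cs = map (\<lambda>l. 3 * l) (literals vs) @ map (\<lambda>l. Suc (3 * l)) (literals vs) @
    map (\<lambda>qC. 3 * fst qC + 2) (rev (List.enumerate 0 Cs))"

definition graph_edges :: "nat list \<Rightarrow> nat list list \<Rightarrow> (nat \<times> nat) list" where
  "graph_edges vs Cs = map (\<lambda>v. (3 * (2 * v), 3 * Suc (2 * v))) vs @
    map (\<lambda>l. (3 * l, Suc (3 * l))) (literals vs) @
    concat (map (\<lambda>qC. map (\<lambda>l. (3 * l, 3 * fst qC + 2))
      (filter (\<lambda>l. \<exists>l'\<in>set (snd qC). l' = l) (literals vs))) (rev (List.enumerate 0 Cs)))"

lemma polytime_literals [polytime_intros]: "polytime f \<Longrightarrow> polytime (\<lambda>x. literals (f x))"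
  unfolding literals_def by (intro polytime_intros)

lemma polytime_copies [polytime_intros]:
  assumes "polytime f" "polytime g" shows "polytime (\<lambda>x. copies (f x) (g x))"
proof -
  have "polytime (\<lambda>x. copies (fst x) (snd x))"
    unfolding copies_def literal_number_def by (intro polytime_intros)
  from polytime_comp[OF this polytime_Pair[OF assms]] show ?thesis by simp
qed

lemma polytime_graph_vertices [polytime_intros]:
  assumes "polytime f" "polytime g" shows "polytime (\<lambda>x. graph_vertices (f x) (g x))"
  unfolding graph_vertices_def by (intro polytime_intros assms)

lemma polytime_graph_edges [polytime_intros]:
  assumes "polytime f" "polytime g" shows "polytime (\<lambda>x. graph_edges (f x) (g x))"
proof -
  have "polytime (\<lambda>x. graph_edges (fst x) (snd x))"
    unfolding graph_edges_def by (intro polytime_intros)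
  from polytime_comp[OF this polytime_Pair[OF assms]] show ?thesis by simp
qed


section \<open>Answering the queries greedily\<close>

text \<open>The greedy maximal independent set in list order. Both orientations are tested because
  an undirected edge is listed only once, in either direction.\<close>

definition greedy :: "nat list \<Rightarrow> (nat \<times> nat) list \<Rightarrow> nat list" where
  "greedy vs es = foldl (\<lambda>acc y. if \<exists>z\<in>set acc. \<exists>e\<in>set es.
    fst e = z \<and> snd e = y \<or> fst e = y \<and> snd e = z then acc else y # acc) [] vs"

text \<open>A query pairs the graph with its parameter, so the vertex and edge lists are the two
  halves of \<open>left d\<close>.\<close>

definition greedy_answer :: "data \<Rightarrow> nat list" where
  "greedy_answer d = greedy (map (\<lambda>v. nat_of v) (datalist (left (left d))))
    (map (\<lambda>e. (nat_of (left e), nat_of (right e))) (datalist (right (left d))))"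

lemma polytime_greedy [polytime_intros]:
  assumes "polytime f" "polytime g" shows "polytime (\<lambda>x. greedy (f x) (g x))"
proof -
  have "polytime (\<lambda>x. greedy (fst x) (snd x))"
    unfolding greedy_def
    by (intro polytime_foldl_increment[where D = "\<lambda>n. n + 1"] polytime_intros
        poly_bounded_add poly_bounded_id poly_bounded_const)
      (auto dest: size_enc_member)
  from polytime_comp[OF this polytime_Pair[OF assms]] show ?thesis by simp
qed

lemma polytime_greedy_answer: "polytime greedy_answer"
  unfolding greedy_answer_def by (intro polytime_intros)


section \<open>Correctness of the reduction\<close>

lemma set_literals: "l \<in> set (literals vs) \<longleftrightarrow> l div 2 \<in> set vs"
proof
  assume "l div 2 \<in> set vs"
  moreover have "l = 2 * (l div 2) \<or> l = Suc (2 * (l div 2))" by arith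
  ultimately show "l \<in> set (literals vs)" unfolding literals_def by fastforce
qed (auto simp: literals_def)

lemma length_literals [simp]: "length (literals vs) = 2 * length vs"
  by (induction vs) (auto simp: literals_def)

lemma distinct_literals: "distinct vs \<Longrightarrow> distinct (literals vs)"
proof (induction vs)
  case (Cons v vs)
  then have "2 * v \<notin> set (literals vs)" "Suc (2 * v) \<notin> set (literals vs)"
    by (auto simp: set_literals)
  then show ?case using Cons by (auto simp: literals_def)
qed (simp add: literals_def)

lemma set_rev_enumerate: "set (rev (List.enumerate 0 xs)) = (\<lambda>q. (q, xs ! q)) ` {..<length xs}"
  by (force simp: in_set_enumerate_eq)

lemma distinct_map_rev_enumerate:
  "inj_on f {..<length xs} \<Longrightarrow> distinct (map (\<lambda>qC. f (fst qC)) (rev (List.enumerate 0 xs)))"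
proof -
  assume "inj_on f {..<length xs}"
  then have "distinct (map f (map fst (List.enumerate 0 xs)))"
    by (subst distinct_map) (auto simp: lessThan_atLeast0)
  moreover have "map (\<lambda>qC. f (fst qC)) (List.enumerate 0 xs) = map f (map fst (List.enumerate 0 xs))"
    unfolding map_map by (simp add: comp_def)
  ultimately show ?thesis by (simp only: rev_map[symmetric] distinct_rev)
qed

definition reduction_graph :: "nat list \<Rightarrow> nat list list \<Rightarrow> graph" where
  "reduction_graph vs Cs =
    (set (graph_vertices vs Cs), (\<lambda>(u, v). {u, v}) ` set (graph_edges vs Cs))"

lemma set_graph_vertices: "set (graph_vertices vs Cs) = (\<lambda>l. 3 * l) ` set (literals vs) \<union>
    (\<lambda>l. 3 * l + 1) ` set (literals vs) \<union> (\<lambda>q. 3 * q + 2) ` {..<length Cs}"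
  unfolding graph_vertices_def set_append set_map set_rev_enumerate by (auto simp: image_image)

lemma distinct_graph_vertices: "distinct vs \<Longrightarrow> distinct (graph_vertices vs Cs)"
proof -
  assume "distinct vs"
  then have "distinct (literals vs)" by (rule distinct_literals)
  moreover have "distinct (map (\<lambda>qC. 3 * fst qC + 2) (rev (List.enumerate 0 Cs)))"
    by (rule distinct_map_rev_enumerate) (auto simp: inj_on_def)
  \<comment> \<open>The residue modulo 3 separates literal, pendant and clause vertices.\<close>
  moreover have "3 * l \<noteq> Suc (3 * l')" "3 * l \<noteq> 3 * l' + 2" "Suc (3 * l) \<noteq> 3 * l' + 2" for l l' :: nat
    by presburger+
  ultimately show ?thesis unfolding graph_vertices_def
    by (auto simp: distinct_map inj_on_def)
qed

lemma in_graph_edges: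
  "(x, y) \<in> set (graph_edges vs Cs) \<longleftrightarrow>
    (\<exists>v\<in>set vs. x = 3 * (2 * v) \<and> y = 3 * Suc (2 * v)) \<or>
    (\<exists>l\<in>set (literals vs). x = 3 * l \<and> y = 3 * l + 1) \<or>
    (\<exists>q<length Cs. \<exists>l\<in>set (literals vs) \<inter> set (Cs ! q). x = 3 * l \<and> y = 3 * q + 2)"
  unfolding graph_edges_def set_append set_map set_concat set_rev_enumerate by auto

lemma distinct_graph_edges: "distinct vs \<Longrightarrow> distinct (graph_edges vs Cs)"
proof -
  assume vs: "distinct vs"
  then have lits: "distinct (literals vs)" by (rule distinct_literals)
  let ?f = "\<lambda>qC :: nat \<times> nat list. map (\<lambda>l. (3 * l, 3 * fst qC + 2))
    (filter (\<lambda>l. \<exists>l'\<in>set (snd qC). l' = l) (literals vs))"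
  \<comment> \<open>Generalized for the induction to any list of numbered clauses; distinct numbers
    keep the edges of different clauses apart.\<close>
  have "distinct (concat (map ?f qCs))" if "distinct (map fst qCs)" for qCs
    using that
  proof (induction qCs)
    case (Cons qC qCs)
    have "distinct (?f qC)" using lits by (auto simp: distinct_map inj_on_def)
    moreover have "fst qC' \<noteq> fst qC" if "qC' \<in> set qCs" for qC' 
    proof -
      have "fst qC' \<in> fst ` set qCs" using that by (rule imageI)
      moreover have "fst qC \<notin> fst ` set qCs" using Cons.prems by simp
      ultimately show ?thesis by metis
    qed
    then have "set (?f qC) \<inter> set (concat (map ?f qCs)) = {}" by auto blast
    ultimately show ?case using Cons by simp
  qed simp
  from this[of "rev (List.enumerate 0 Cs)"]
  have "distinct (concat (map ?f (rev (List.enumerate 0 Cs))))" by (simp add: rev_map[symmetric])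
  moreover have "distinct (map (\<lambda>v. (3 * (2 * v), 3 * Suc (2 * v))) vs)"
    "distinct (map (\<lambda>l. (3 * l, Suc (3 * l))) (literals vs))"
    using vs lits by (auto simp: distinct_map inj_on_def)
  \<comment> \<open>The second endpoints of the three kinds of edges have residues 0, 1 and 2 modulo
    3.\<close>
  moreover have "3 * Suc (2 * v) \<noteq> Suc (3 * l)" "3 * Suc (2 * v) \<noteq> 3 * q + 2" "Suc (3 * l) \<noteq> 3 * q + 2"
    for v l q :: nat by presburger+
  ultimately show ?thesis unfolding graph_edges_def
    by (auto simp del: mult_Suc_right)
qed

text \<open>Every edge is listed starting from a literal vertex, and an edge between two literals
  from the smaller to the larger one. This orientation rules out loops and an edge listed in both
  directions.\<close>

lemma graph_edges_mod:
  assumes "(x, y) \<in> set (graph_edges vs Cs)" shows "x mod 3 = 0 \<and> (y mod 3 = 0 \<longrightarrow> x < y)"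
  using assms unfolding in_graph_edges
proof (elim disjE bexE exE conjE, goal_cases)
  case (1 v) show ?case using 1(2,3) by presburger
next
  case (2 l) show ?case using 2(2,3) by presburger
next
  case (3 q l) show ?case using 3(3,4) by presburger
qed

lemma graph_edges_orientation:
  assumes "(u, v) \<in> set (graph_edges vs Cs)" shows "(v, u) \<notin> set (graph_edges vs Cs)" "u \<noteq> v"
  using graph_edges_mod[of u v vs Cs] graph_edges_mod[of v u vs Cs] assms by auto

lemma enc_nat_list: "enc (ns :: nat list) = list_code (map nat_code ns)"
  by (induction ns) auto

lemma enc_edge_list:
  "enc (es :: (nat \<times> nat) list) = list_code (map (\<lambda>(u, v). Node (nat_code u) (nat_code v)) es)"
  by (induction es) auto

lemma codes_reduction_graph:
  assumes "distinct vs"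
  shows "codes_graph (enc (graph_vertices vs Cs, graph_edges vs Cs)) (reduction_graph vs Cs)"
proof -
  \<comment> \<open>As no edge is listed in both directions, forgetting the orientation identifies
    no two edges.\<close>
  have "inj_on (\<lambda>(u, v). {u, v}) (set (graph_edges vs Cs))"
    using graph_edges_orientation(1) by (fastforce simp: inj_on_def doubleton_eq_iff)
  then have "distinct (map (\<lambda>(u, v). {u, v}) (graph_edges vs Cs))"
    using distinct_graph_edges[OF assms] by (simp add: distinct_map)
  then have "codes_edge_set (enc (graph_edges vs Cs)) ((\<lambda>(u, v). {u, v}) ` set (graph_edges vs Cs))"
    unfolding codes_edge_set_def
    by (intro exI[of _ "graph_edges vs Cs"]) (auto simp: enc_edge_list)
  moreover have "codes_vertex_set (enc (graph_vertices vs Cs)) (set (graph_vertices vs Cs))"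
    unfolding codes_vertex_set_def
    by (intro exI[of _ "graph_vertices vs Cs"])
      (auto simp: enc_nat_list distinct_graph_vertices[OF assms])
  ultimately show ?thesis by (auto simp: codes_graph_def reduction_graph_def)
qed

lemma simple_reduction_graph: "simple_graph (reduction_graph vs Cs)"
proof -
  have "u \<in> set (graph_vertices vs Cs) \<and> v \<in> set (graph_vertices vs Cs)"
    if "(u, v) \<in> set (graph_edges vs Cs)" for u v
  proof -
    have "2 * v \<in> set (literals vs) \<and> Suc (2 * v) \<in> set (literals vs)" if "v \<in> set vs" for v
      using that by (simp add: set_literals)
    then show ?thesis using that unfolding in_graph_edges set_graph_vertices by blast
  qed
  then show ?thesis using graph_edges_orientation(2)
    by (fastforce simp: simple_graph_def reduction_graph_def)
qed

text \<open>The literal vertices cover all edges, and the pendant edges form a matching of the same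
  size, so no cover is smaller.\<close>

lemma vertex_cover_number_reduction_graph:
  assumes "distinct vs"
  shows "vertex_cover_number (reduction_graph vs Cs) = 2 * length vs"
proof -
  let ?G = "reduction_graph vs Cs" and ?L = "set (literals vs)"
  have card: "card ?L = 2 * length vs"
    using distinct_card[OF distinct_literals[OF assms]] by simp
  have cover: "vertex_cover ?G ((\<lambda>l. 3 * l) ` ?L)"
    unfolding vertex_cover_def reduction_graph_def
    by (auto simp: set_graph_vertices in_graph_edges set_literals)
  have fin: "finite {X. vertex_cover ?G X}"
    by (rule finite_subset[of _ "Pow (set (graph_vertices vs Cs))"])
      (auto simp: vertex_cover_def reduction_graph_def)
  have "2 * length vs \<le> card X" if X: "vertex_cover ?G X" for X
  proof -
    have "finite X" using X
      by (auto simp: vertex_cover_def reduction_graph_def intro: finite_subset)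
    \<comment> \<open>Division by 3 sends both ends of the pendant edge of \<open>l\<close> to
      \<open>l\<close>; hence a cover maps onto the literals.\<close>
    have "l \<in> (\<lambda>x. x div 3) ` X" if "l \<in> ?L" for l
    proof -
      have "(3 * l, 3 * l + 1) \<in> set (graph_edges vs Cs)" using that by (auto simp: in_graph_edges)
      then have "{3 * l, 3 * l + 1} \<inter> X \<noteq> {}"
        using X unfolding vertex_cover_def reduction_graph_def by fastforce
      then have "3 * l \<in> X \<or> 3 * l + 1 \<in> X" by blast
      moreover have "3 * l div 3 = l" "(3 * l + 1) div 3 = l" by presburger+
      ultimately show ?thesis by (metis image_eqI)
    qed
    then have "?L \<subseteq> (\<lambda>x. x div 3) ` X" by blast
    from surj_card_le[OF \<open>finite X\<close> this] show ?thesis using card by simp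
  qed
  moreover have "2 * length vs \<in> card ` {X. vertex_cover ?G X}"
    using cover card by (intro image_eqI[of _ _ "(\<lambda>l. 3 * l) ` ?L"]) (auto simp: card_image inj_on_def)
  ultimately show ?thesis
    unfolding vertex_cover_number_def using fin by (intro Min_eqI) auto
qed

definition edge_of :: "(nat \<times> nat) list \<Rightarrow> nat \<Rightarrow> nat \<Rightarrow> bool" where
  "edge_of es u v \<longleftrightarrow> (u, v) \<in> set es \<or> (v, u) \<in> set es"

lemma in_edge_image: "{u, v} \<in> (\<lambda>(u, v). {u, v}) ` set es \<longleftrightarrow> edge_of es u v"
  by (auto simp: edge_of_def doubleton_eq_iff image_iff)

lemma independent_dominating_set_edge_of:
  "independent_dominating_set (V, (\<lambda>(u, v). {u, v}) ` set es) X \<longleftrightarrow>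
    X \<subseteq> V \<and> (\<forall>u\<in>X. \<forall>v\<in>X. \<not> edge_of es u v) \<and> (\<forall>v\<in>V. v \<in> X \<or> (\<exists>u\<in>X. edge_of es u v))"
  by (auto simp: independent_dominating_set_def closed_neighborhood_def in_edge_image)

text \<open>Truth of a literal given by its number; odd numbers are the positive literals.\<close>

definition satisfies :: "(nat \<Rightarrow> bool) \<Rightarrow> nat \<Rightarrow> bool" where
  "satisfies a l \<longleftrightarrow> a (l div 2) = odd l"

lemma satisfies_literal_number: "satisfies a (literal_number (v, b)) \<longleftrightarrow> a v = b"
  by (auto simp: satisfies_def literal_number_def)

text \<open>Take the vertices of the true literals and the pendant neighbours of the false ones.
  Opposite literals are never both true, each pendant edge contains a chosen end, and a true literal
  dominates each clause vertex. One vertex per literal gives the size.\<close>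

lemma independent_dominating_set_of_assignment:
  assumes vs: "distinct vs" and Cs: "\<And>C. C \<in> set Cs \<Longrightarrow> set C \<subseteq> set (literals vs)"
    and a: "\<And>C. C \<in> set Cs \<Longrightarrow> \<exists>l\<in>set C. satisfies a l"
  shows "\<exists>X. independent_dominating_set (reduction_graph vs Cs) X \<and> card X \<le> 2 * length vs"
proof -
  let ?L = "set (literals vs)"
  let ?g = "\<lambda>l. if satisfies a l then 3 * l else 3 * l + 1"
  define Y where "Y = ?g ` ?L"
  have X: "3 * l \<in> Y \<longleftrightarrow> l \<in> ?L \<and> satisfies a l" "3 * l + 1 \<in> Y \<longleftrightarrow> l \<in> ?L \<and> \<not> satisfies a l"
    "3 * l + 2 \<notin> Y" for l
    unfolding Y_def by (auto simp: image_iff split: if_splits; presburger)+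
  have sub: "Y \<subseteq> set (graph_vertices vs Cs)" by (auto simp: Y_def set_graph_vertices)
  have "\<not> (u \<in> Y \<and> v \<in> Y)" if "(u, v) \<in> set (graph_edges vs Cs)" for u v
    using that unfolding in_graph_edges
  proof (elim disjE bexE exE conjE, goal_cases)
    case (1 v')
    have "satisfies a (Suc (2 * v')) \<longleftrightarrow> \<not> satisfies a (2 * v')" by (simp add: satisfies_def)
    then show ?case using 1(2,3) X(1)[of "2 * v'"] X(1)[of "Suc (2 * v')"] by blast
  next
    case (2 l) then show ?case using X[of l] by blast
  next
    case (3 q l) then show ?case using X(3)[of q] by blast
  qed
  then have indep: "\<forall>u\<in>Y. \<forall>v\<in>Y. \<not> edge_of (graph_edges vs Cs) u v"
    unfolding edge_of_def by blast
  have dom: "v \<in> Y \<or> (\<exists>u\<in>Y. edge_of (graph_edges vs Cs) u v)"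
    if "v \<in> set (graph_vertices vs Cs)" for v
    using that unfolding set_graph_vertices
  proof (elim UnE imageE)
    fix l assume l: "v = 3 * l" "l \<in> ?L"
    then have "edge_of (graph_edges vs Cs) (3 * l + 1) v"
      unfolding edge_of_def in_graph_edges by blast
    then show ?thesis using l X[of l] by blast
  next
    fix l assume l: "v = 3 * l + 1" "l \<in> ?L"
    then have "edge_of (graph_edges vs Cs) (3 * l) v"
      unfolding edge_of_def in_graph_edges by blast
    then show ?thesis using l X[of l] by blast
  next
    fix q assume q: "v = 3 * q + 2" "q \<in> {..<length Cs}"
    then obtain l where l: "l \<in> set (Cs ! q)" "satisfies a l" "l \<in> ?L"
      using a[of "Cs ! q"] Cs[of "Cs ! q"] by auto
    then have "edge_of (graph_edges vs Cs) (3 * l) v"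
      using q unfolding edge_of_def in_graph_edges by blast
    then show ?thesis using l X[of l] by blast
  qed
  have "card (Y) \<le> 2 * length vs"
    unfolding Y_def using card_image_le[of ?L ?g] card_length[of "literals vs"] by simp
  moreover have "independent_dominating_set (reduction_graph vs Cs) (Y)"
    unfolding reduction_graph_def independent_dominating_set_edge_of by (intro conjI sub indep ballI dom)
  ultimately show ?thesis by blast
qed

text \<open>
  If the set contains a clause vertex, then none of the literals of this clause, and hence all the
  copies of the clause vertex.
\<close>

lemma assignment_of_independent_dominating_set:
  assumes Cs: "\<And>C. C \<in> set Cs \<Longrightarrow> set C \<subseteq> set (literals vs)"
    and many: "\<And>C. C \<in> set Cs \<Longrightarrow> T \<le> length (filter (\<lambda>C'. C' = C) Cs)"
    and X: "independent_dominating_set (reduction_graph vs Cs) X" and "card X < T"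
  shows "\<exists>a. \<forall>C\<in>set Cs. \<exists>l\<in>set C. satisfies a l"
proof -
  let ?e = "edge_of (graph_edges vs Cs)"
  from X have sub: "X \<subseteq> set (graph_vertices vs Cs)" and indep: "\<And>u v. u \<in> X \<Longrightarrow> v \<in> X \<Longrightarrow> \<not> ?e u v"
    and dom: "\<And>v. v \<in> set (graph_vertices vs Cs) \<Longrightarrow> v \<in> X \<or> (\<exists>u\<in>X. ?e u v)"
    unfolding reduction_graph_def independent_dominating_set_edge_of by blast+
  have "finite X" using sub finite_subset by blast
  have clause_edge: "?e u (3 * q + 2) \<longleftrightarrow> (\<exists>l\<in>set (literals vs) \<inter> set (Cs ! q). u = 3 * l)"
    if "q < length Cs" for u q
  proof
    assume "?e u (3 * q + 2)"
    moreover have "(3 * q + 2, u) \<notin> set (graph_edges vs Cs)"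

    proof
      assume "(3 * q + 2, u) \<in> set (graph_edges vs Cs)"
      from graph_edges_mod[OF this] show False by presburger
    qed
    ultimately have "(u, 3 * q + 2) \<in> set (graph_edges vs Cs)" by (simp add: edge_of_def)
    then show "\<exists>l\<in>set (literals vs) \<inter> set (Cs ! q). u = 3 * l"
      unfolding in_graph_edges
    proof (elim disjE bexE exE conjE, goal_cases)
      case (1 v) then show ?case using 1(3) by presburger
    next
      case (2 l) then show ?case using 2(3) by presburger
    next
      case (3 q' l) then show ?case by auto
    qed
  next
    assume "\<exists>l\<in>set (literals vs) \<inter> set (Cs ! q). u = 3 * l"
    then show "?e u (3 * q + 2)" using that unfolding edge_of_def in_graph_edges by blast
  qed
  have clause_dom: "3 * q + 2 \<in> X \<or> (\<exists>l\<in>set (Cs ! q). 3 * l \<in> X)" if q: "q < length Cs" for q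
    using dom[of "3 * q + 2"] clause_edge[OF q] q by (auto simp: set_graph_vertices)
  have no_clause: "3 * q + 2 \<notin> X" if q: "q < length Cs" for q
  proof
    assume qX: "3 * q + 2 \<in> X"
    have "3 * q' + 2 \<in> X" if q': "q' < length Cs" "Cs ! q' = Cs ! q" for q'
    proof (rule ccontr)
      assume "3 * q' + 2 \<notin> X"
      then obtain l where l: "l \<in> set (Cs ! q)" "3 * l \<in> X" using clause_dom[OF q'(1)] q' by auto
      then have "l \<in> set (literals vs)" using Cs[of "Cs ! q"] q by auto
      then have "?e (3 * l) (3 * q + 2)" using l clause_edge[OF q] by blast
      then show False using indep l qX by blast
    qed
    \<comment> \<open>By \<open>many\<close> there are at least \<open>T\<close> such positions,
      giving as many vertices of \<open>X\<close>, against \<open>card X < T\<close>.\<close>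
    then have "(\<lambda>q'. 3 * q' + 2) ` {q'. q' < length Cs \<and> Cs ! q' = Cs ! q} \<subseteq> X" by blast
    from card_mono[OF \<open>finite X\<close> this]
    have "length (filter (\<lambda>C'. C' = Cs ! q) Cs) \<le> card X"
      by (simp add: length_filter_conv_card card_image inj_on_def)
    then show False using many[of "Cs ! q"] q \<open>card X < T\<close> by simp
  qed
  \<comment> \<open>A variable neither of whose literals is chosen becomes false; this is harmless,
    since every clause has a chosen literal.\<close>
  define a where "a v \<longleftrightarrow> 3 * Suc (2 * v) \<in> X" for v
  have sat: "satisfies a l" if "3 * l \<in> X" "l \<in> set (literals vs)" for l
  proof (cases "odd l")
    case True
    then have "l = Suc (2 * (l div 2))" by presburger
    then show ?thesis using that True unfolding satisfies_def a_def by metis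
  next
    case False
    then have l: "l = 2 * (l div 2)" by presburger
    have "?e (3 * (2 * (l div 2))) (3 * Suc (2 * (l div 2)))"
      using that(2) unfolding edge_of_def in_graph_edges set_literals by blast
    then have "\<not> a (l div 2)" using indep that(1) l unfolding a_def by metis
    then show ?thesis using False by (simp add: satisfies_def)
  qed
  have "\<exists>l\<in>set C. satisfies a l" if "C \<in> set Cs" for C
  proof -
    from that obtain q where q: "q < length Cs" "C = Cs ! q" by (metis in_set_conv_nth)
    then show ?thesis using clause_dom[of q] no_clause[of q] sat Cs[OF that] by blast
  qed
  then show ?thesis by blast
qed

section \<open>Copies of clauses and the gap in the optimum\<close>

lemma set_copies: "T > 0 \<Longrightarrow> set (copies T \<phi>) = map literal_number ` set \<phi>"
  by (auto simp: copies_def)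

text \<open>Each of the \<open>T\<close> rounds contributes at least one occurrence; clauses
  repeated in the formula only add more.\<close>

lemma filter_copies: 
  assumes "C \<in> set (copies T \<phi>)" shows "T \<le> length (filter (\<lambda>C'. C' = C) (copies T \<phi>))"
proof -
  have "C \<in> set (map (map literal_number) \<phi>)" using assms by (auto simp: copies_def split: if_splits)
  then have 1: "1 \<le> length (filter (\<lambda>C'. C' = C) (map (map literal_number) \<phi>))"
    by (metis (mono_tags, lifting) One_nat_def Suc_leI filter_empty_conv length_greater_0_conv)
  have "T' \<le> length (filter (\<lambda>C'. C' = C) (copies T' \<phi>))" for T'
    using 1 by (induction T') (auto simp: copies_def)
  then show ?thesis .
qed

lemma literals_copies: "C \<in> set (copies T \<phi>) \<Longrightarrow> set C \<subseteq> set (literals (cnf_vars \<phi>))"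
  by (cases "T = 0")
    (force simp: copies_def set_literals set_cnf_vars variables_def literal_number_def)+

lemma satisfiable_copies:
  assumes "T > 0"
  shows "satisfiable \<phi> \<longleftrightarrow> (\<exists>a. \<forall>C\<in>set (copies T \<phi>). \<exists>l\<in>set C. satisfies a l)"
proof -
  have "(\<exists>l\<in>literal_number ` set C. satisfies a l) \<longleftrightarrow> (\<exists>(v, b)\<in>set C. a v = b)" for a C
    by (force simp: satisfies_literal_number)
  then show ?thesis by (simp add: set_copies[OF assms] satisfiable_def)
qed

text \<open>A satisfying assignment keeps the optimum at most \<open>2 * n\<close>, so the solution
  costs at most \<open>c * (2 * n) < T\<close>. Conversely any feasible set below \<open>T\<close>,
  optimal or not, yields an assignment.\<close>

lemma satisfiable_iff_approx_solution:
  assumes y: "approx_solution IDS_vc c (reduction_graph (cnf_vars \<phi>) (copies T \<phi>)) y"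
    and T: "c * real (2 * length (cnf_vars \<phi>)) < real T" "c \<ge> 0"
  shows "satisfiable \<phi> \<longleftrightarrow> length (datalist y) < T"
proof -
  let ?G = "reduction_graph (cnf_vars \<phi>) (copies T \<phi>)"
  have "T > 0" using T by (cases T) (auto simp: mult_less_0_iff)
  from y obtain S where S: "codes_vertex_set y S" "independent_dominating_set ?G S"
    "real (card S) \<le> c * opt IDS_vc ?G"
    by (auto simp: approx_solution_def IDS_vc_def)
  from S(1) have len: "length (datalist y) = card S"
    by (auto simp: codes_vertex_set_def distinct_card)
  show ?thesis
  proof
    assume "satisfiable \<phi>"
    then obtain a where "\<forall>C\<in>set (copies T \<phi>). \<exists>l\<in>set C. satisfies a l"
      using satisfiable_copies[OF \<open>T > 0\<close>] by blast
    then obtain X where X: "independent_dominating_set ?G X" "card X \<le> 2 * length (cnf_vars \<phi>)"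
      using independent_dominating_set_of_assignment
        [of "cnf_vars \<phi>" "copies T \<phi>" a] distinct_cnf_vars literals_copies by blast
    have "opt IDS_vc ?G \<le> real (card X)"
      unfolding opt_def IDS_vc_def using X(1)
      by (intro cInf_lower) (auto intro: bdd_belowI[of _ 0])
    then have "c * opt IDS_vc ?G \<le> c * real (2 * length (cnf_vars \<phi>))"
      using X(2) T(2) by (intro mult_left_mono) linarith+
    then show "length (datalist y) < T" using S(3) T(1) len by linarith
  next
    assume "length (datalist y) < T"
    then show "satisfiable \<phi>"
      using assignment_of_independent_dominating_set[OF literals_copies filter_copies S(2)] len
        satisfiable_copies[OF \<open>T > 0\<close>] by simp
  qed
qed


section \<open>The greedy answers are approximate\<close>

lemma greedy_snoc: "greedy (vs @ [y]) es =
   (if \<exists>z\<in>set (greedy vs es). edge_of es z y then greedy vs es else y # greedy vs es)"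
proof -
  have "(\<exists>e\<in>set es. fst e = z \<and> snd e = y \<or> fst e = y \<and> snd e = z) \<longleftrightarrow> edge_of es z y" for z
    by (force simp: edge_of_def)
  then show ?thesis by (simp add: greedy_def)
qed

text \<open>Induction on the scanned prefix: the next vertex has a chosen neighbour, and is
  dominated, or is chosen itself. Without loops a chosen vertex does not conflict with
  itself.\<close>

lemma greedy_independent_dominating_set:
  assumes "\<And>u v. (u, v) \<in> set es \<Longrightarrow> u \<noteq> v"
  shows "independent_dominating_set (set vs, (\<lambda>(u, v). {u, v}) ` set es) (set (greedy vs es))"
  unfolding independent_dominating_set_edge_of
proof (induction vs rule: rev_induct)
  case (snoc y vs)
  moreover have "edge_of es u v \<longleftrightarrow> edge_of es v u" "\<not> edge_of es u u" for u v
    using assms by (auto simp: edge_of_def)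
  ultimately show ?case by (auto simp: greedy_snoc)
qed (simp add: greedy_def)

lemma set_greedy: "set (greedy vs es) \<subseteq> set vs"
  by (induction vs rule: rev_induct) (auto simp: greedy_snoc, simp add: greedy_def)

lemma distinct_greedy: "distinct vs \<Longrightarrow> distinct (greedy vs es)"
proof (induction vs rule: rev_induct)
  case (snoc y vs)
  then show ?case using set_greedy[of vs es] by (auto simp: greedy_snoc)
qed (simp add: greedy_def)

text \<open>The answer costs at most the number of vertices, which is at most the size of the query
  and hence at most \<open>c\<close>, while the optimum of a nonempty graph is at least 1. For the
  empty graph the answer is empty and costs 0.\<close>

lemma greedy_answer_approx:
  assumes "real b \<le> c" "1 \<le> c"
  shows "approx_oracle IDS_vc c b (\<lambda>d. enc (greedy_answer d))"
  unfolding approx_oracle_def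
proof (intro allI impI, elim conjE)
  fix G x
  assume G: "is_instance IDS_vc G" and x: "codes_instance IDS_vc x G"
    and le: "size x + parameter IDS_vc G \<le> b"
  from x obtain V E dV dE where V: "G = (V, E)" "x = Node dV dE" "codes_vertex_set dV V" "codes_edge_set dE E"
    by (cases G) (auto simp: IDS_vc_def codes_graph_def)
  from V(3) obtain vs where vs: "distinct vs" "V = set vs" "dV = list_code (map nat_code vs)"
    by (auto simp: codes_vertex_set_def)
  from V(4) obtain es where es: "E = (\<lambda>(u, v). {u, v}) ` set es"
    "dE = list_code (map (\<lambda>(u, v). Node (nat_code u) (nat_code v)) es)"
    by (auto simp: codes_edge_set_def)
  have loops: "u \<noteq> v" if "(u, v) \<in> set es" for u v
    using G that by (fastforce simp: IDS_vc_def simple_graph_def V(1) es(1) doubleton_eq_iff)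
  let ?X = "set (greedy vs es)"
  have X: "independent_dominating_set G ?X"
    using greedy_independent_dominating_set[OF loops] V(1) vs es by simp
  have "map (\<lambda>e. (nat_of (left e), nat_of (right e))) (datalist dE) = es"
    by (simp add: es(2) comp_def case_prod_unfold)
  then have ans: "greedy_answer (input_code x k) = greedy vs es" for k
    by (simp add: greedy_answer_def input_code_def V(2) vs(3) comp_def)
  have "codes_vertex_set (enc (greedy vs es)) ?X"
    using distinct_greedy[OF vs(1)] by (auto simp: codes_vertex_set_def enc_nat_list)
  moreover have "real (card ?X) \<le> c * opt IDS_vc G"
  proof (cases "V = {}")
    case True
    then have "?X = {}" using set_greedy[of vs es] vs by simp
    moreover have "0 \<le> opt IDS_vc G"
      unfolding opt_def using X by (intro cInf_greatest) (auto simp: IDS_vc_def)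
    ultimately show ?thesis using assms by simp
  next
    case False
    have "1 \<le> card S" if "independent_dominating_set G S" for S
    proof -
      have "finite S" "S \<noteq> {}"
        using that False V(1) vs(2)
        by (auto simp: independent_dominating_set_def closed_neighborhood_def intro: finite_subset)
      then show ?thesis by (simp add: Suc_leI card_gt_0_iff)
    qed
    then have "1 \<le> opt IDS_vc G"
      unfolding opt_def using X by (intro cInf_greatest) (auto simp: IDS_vc_def)
    have "card ?X \<le> length vs" using card_mono[OF _ set_greedy] card_length le_trans by blast
    also have "length vs \<le> size x"
      using length_le_size_enc[of vs] V(2) vs(3) by (simp add: enc_nat_list)
    finally have "real (card ?X) \<le> c * 1" using le assms by linarith
    also have "\<dots> \<le> c * opt IDS_vc G" using \<open>1 \<le> opt IDS_vc G\<close> assms by (intro mult_left_mono) auto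
    finally show ?thesis .
  qed
  ultimately show "approx_solution IDS_vc c G (enc (greedy_answer (input_code x (parameter IDS_vc G))))"
    unfolding approx_solution_def ans using X by (auto simp: IDS_vc_def)
qed


section \<open>Simulating the oracle\<close>

primrec exp_bound :: "exp \<Rightarrow> nat" where
  "exp_bound (Var x) = Suc x"
| "exp_bound LeafE = 0"
| "exp_bound (NodeE e1 e2) = max (exp_bound e1) (exp_bound e2)"
| "exp_bound (Left e) = exp_bound e"
| "exp_bound (Right e) = exp_bound e"

text \<open>All variables of the program lie strictly below this bound; the cells from there on are
  free for the simulation.\<close>

primrec com_bound :: "com \<Rightarrow> nat" where
  "com_bound Skip = 0"
| "com_bound (Assign x e) = max (Suc x) (exp_bound e)"
| "com_bound (Query x e) = max (Suc x) (exp_bound e)"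
| "com_bound (Seq c1 c2) = max (com_bound c1) (com_bound c2)"
| "com_bound (If e c1 c2) = max (exp_bound e) (max (com_bound c1) (com_bound c2))"
| "com_bound (While e c) = max (exp_bound e) (com_bound c)"

lemma evalE_cong: "exp_bound e \<le> N \<Longrightarrow> (\<And>i. i < N \<Longrightarrow> s i = s' i) \<Longrightarrow> evalE e s = evalE e s'"
  by (induction e) auto

text \<open>Queries are answered from base \<open>N + 1\<close> on, which leaves cell
  \<open>N\<close> to the surrounding program.\<close>

primrec answer_queries :: "nat \<Rightarrow> com \<Rightarrow> com \<Rightarrow> com" where
  "answer_queries N d Skip = Skip"
| "answer_queries N d (Assign x e) = Assign x e"
| "answer_queries N d (Query x e) = Seq (Assign (N + 1) e) (Seq d (Assign x (Var (N + 1))))"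
| "answer_queries N d (Seq c1 c2) = Seq (answer_queries N d c1) (answer_queries N d c2)"
| "answer_queries N d (If e c1 c2) = If e (answer_queries N d c1) (answer_queries N d c2)"
| "answer_queries N d (While e c) = While e (answer_queries N d c)"

text \<open>A query is charged its full size, so a run within time \<open>B\<close> asks only
  queries of size at most \<open>B\<close>, each answered within \<open>poly p B\<close>. The bound
  \<open>B\<close> is kept apart from \<open>t\<close>, so that all parts of the run share the same
  factor.\<close>

lemma runs_answer_queries:
  fixes f :: "data \<Rightarrow> 'a::coded"
  assumes d: "implements (N + 1) d (poly p) f"
    and "exec (\<lambda>x. enc (f x)) c s t s'" "com_bound c \<le> N" "t \<le> B"
    and "\<And>i. i < N \<Longrightarrow> u i = s i"
  shows "\<exists>u'. runs Or (answer_queries N d c) u (t * (poly p B + 2)) u' \<and>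
    (\<forall>i<N. u' i = s' i) \<and> u' N = u N"
  using assms(2-)
proof (induction arbitrary: u rule: exec.induct)
  case (Skip s)
  then show ?case by (auto intro!: exI[of _ u] runs_mono[OF runs_Skip])
next
  case (Assign x e s)
  have "evalE e u = evalE e s" using Assign by (intro evalE_cong[of e N]) auto
  then have run: "runs Or (answer_queries N d (Assign x e)) u (1 * (poly p B + 2)) (u(x := evalE e s))"
    using runs_mono[OF runs_Assign[of Or x e u], of "1 * (poly p B + 2)"] by simp
  show ?case
    by (rule exI, rule conjI, rule run) (use Assign.prems in auto)
next
  case (Query x e s)
  have e: "evalE e u = evalE e s" using Query by (intro evalE_cong[of e N]) auto
  let ?u1 = "u(N + 1 := evalE e s)"
  have 1: "runs Or (Assign (N + 1) e) u 1 ?u1" using runs_Assign[of Or "N + 1" e u] e by simp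
  obtain u2 where u2: "runs Or d ?u1 (poly p (size (evalE e s))) u2" "u2 (N + 1) = enc (f (evalE e s))"
    "\<And>i. i < N + 1 \<Longrightarrow> u2 i = ?u1 i" using implementsE[OF d, of ?u1 "evalE e s"] by auto
  have 3: "runs Or (Assign x (Var (N + 1))) u2 1 (u2(x := enc (f (evalE e s))))"
    using runs_Assign[of Or x "Var (N + 1)" u2] u2(2) by simp
  have "poly p (size (evalE e s)) \<le> poly p B" using Query.prems by (intro poly_nat_monoD) simp
  then have "1 + (poly p (size (evalE e s)) + 1) \<le> (size (evalE e s) + 1) * (poly p B + 2)"
    by (simp add: algebra_simps)
  note run = runs_mono[OF runs_Seq[OF 1 runs_Seq[OF u2(1) 3]] this]
  show ?case
    unfolding answer_queries.simps
    by (rule exI, rule conjI, rule run) (use Query.prems u2(3) in auto)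
next
  case (Seq c1 s1 t1 s2 c2 t2 s3)
  from Seq.IH(1)[of u] Seq.prems obtain u2 where u2: "runs Or (answer_queries N d c1) u (t1 * (poly p B + 2)) u2"
    "\<And>i. i < N \<Longrightarrow> u2 i = s2 i" "u2 N = u N" by auto
  from Seq.IH(2)[of u2] Seq.prems u2 obtain u3 where u3: "runs Or (answer_queries N d c2) u2 (t2 * (poly p B + 2)) u3"
    "\<And>i. i < N \<Longrightarrow> u3 i = s3 i" "u3 N = u N" by auto
  show ?case using runs_Seq[OF u2(1) u3(1)] u3 by (auto simp: algebra_simps)
next
  case (IfTrue e s c1 t s' c2)
  have e: "evalE e u = evalE e s" using IfTrue.prems by (intro evalE_cong[of e N]) auto
  from IfTrue.IH[of u] IfTrue.prems obtain u2 where u2: "runs Or (answer_queries N d c1) u (t * (poly p B + 2)) u2"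
    "\<And>i. i < N \<Longrightarrow> u2 i = s' i" "u2 N = u N" by auto
  show ?case using runs_mono[OF runs_IfTrue[OF _ u2(1)], of e "(t + 1) * (poly p B + 2)"] e IfTrue.hyps(1) u2(2,3)
    by auto
next
  case (IfFalse e s c2 t s' c1)
  have e: "evalE e u = evalE e s" using IfFalse.prems by (intro evalE_cong[of e N]) auto
  from IfFalse.IH[of u] IfFalse.prems obtain u2 where u2: "runs Or (answer_queries N d c2) u (t * (poly p B + 2)) u2"
    "\<And>i. i < N \<Longrightarrow> u2 i = s' i" "u2 N = u N" by auto
  show ?case using runs_mono[OF runs_IfFalse[OF _ u2(1)], of e "(t + 1) * (poly p B + 2)"] e IfFalse.hyps(1) u2(2,3)
    by auto
next
  case (WhileFalse e s c)
  have e: "evalE e u = evalE e s" using WhileFalse.prems by (intro evalE_cong[of e N]) auto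
  show ?case using runs_mono[OF runs_WhileFalse, of e u "poly p B + 2"] e WhileFalse by auto
next
  case (WhileTrue e s1 c t1 s2 t2 s3)
  have e: "evalE e u = evalE e s1" using WhileTrue.prems by (intro evalE_cong[of e N]) auto
  from WhileTrue.IH(1)[of u] WhileTrue.prems obtain u2 where u2: "runs Or (answer_queries N d c) u (t1 * (poly p B + 2)) u2"
    "\<And>i. i < N \<Longrightarrow> u2 i = s2 i" "u2 N = u N" by auto
  from WhileTrue.IH(2)[of u2] WhileTrue.prems u2
  obtain u3 where u3: "runs Or (While e (answer_queries N d c)) u2 (t2 * (poly p B + 2)) u3"
    "\<And>i. i < N \<Longrightarrow> u3 i = s3 i" "u3 N = u N" by auto
  show ?case
    using runs_mono[OF runs_WhileTrue[OF _ u2(1) u3(1)], of "(t1 + t2 + 1) * (poly p B + 2)"] e WhileTrue.hyps(1) u3(2,3)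
    by (auto simp: algebra_simps)
qed


section \<open>Deciding satisfiability\<close>

definition formula_graph :: "nat \<Rightarrow> cnf \<Rightarrow> nat list \<times> (nat \<times> nat) list" where
  "formula_graph T \<phi> =
    (graph_vertices (cnf_vars \<phi>) (copies T \<phi>), graph_edges (cnf_vars \<phi>) (copies T \<phi>))"

text \<open>A flag for well-formed input, the threshold \<open>T\<close>, and the input for the
  approximate kernelization. The parameter \<open>k\<close> is presented in unary, so polynomially
  many copies in \<open>k\<close> are affordable. The last three components are meaningful only if
  the flag holds.\<close>

definition reduce :: "nat poly \<Rightarrow> data \<times> nat \<Rightarrow> bool \<times> nat \<times> (nat list \<times> (nat \<times> nat) list) \<times> nat" where
  "reduce P xk = (valid_cnf (fst xk) \<and> length (cnf_vars (parse_cnf (fst xk))) = snd xk,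
    poly P (snd xk), formula_graph (poly P (snd xk)) (parse_cnf (fst xk)), 2 * snd xk)"

lemma polytime_reduce: "polytime (reduce P)"
  unfolding reduce_def formula_graph_def by (intro polytime_intros)

text \<open>Valid trees are exactly the codes of formulas, and parsing inverts coding; so the
  existential over formulas becomes a test on the parsed input.\<close>

lemma in_CNF_SAT_n_iff:
  "(x, k) \<in> CNF_SAT_n \<longleftrightarrow>
    valid_cnf x \<and> length (cnf_vars (parse_cnf x)) = k \<and> satisfiable (parse_cnf x)"
proof -
  have card: "card (variables \<phi>) = length (cnf_vars \<phi>)" for \<phi>
    using distinct_card[OF distinct_cnf_vars[of \<phi>]] by (simp add: set_cnf_vars)
  show ?thesis
  proof
    assume "(x, k) \<in> CNF_SAT_n"
    then show "valid_cnf x \<and> length (cnf_vars (parse_cnf x)) = k \<and> satisfiable (parse_cnf x)"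
      by (auto simp: CNF_SAT_n_def card parse_cnf_code valid_cnf_code)
  next
    assume "valid_cnf x \<and> length (cnf_vars (parse_cnf x)) = k \<and> satisfiable (parse_cnf x)"
    then have "(x, k) = (cnf_code (parse_cnf x), card (variables (parse_cnf x))) \<and> satisfiable (parse_cnf x)"
      by (simp add: card cnf_code_parse_cnf)
    then show "(x, k) \<in> CNF_SAT_n" unfolding CNF_SAT_n_def by blast
  qed
qed

text \<open>
  The ratio of the simulated oracle is taken as large as the queries can be, so that every
  independent dominating set is an admissible answer.
\<close>

lemma kernelization_decides_satisfiability:
  assumes "\<alpha> \<ge> 1" "poly_bounded g" "approx_turing_kernelization \<alpha> IDS_vc g prog"
  obtains P q where "\<And>\<phi>. \<exists>t y.
    t \<le> poly q (size (enc (formula_graph (poly P (length (cnf_vars \<phi>))) \<phi>)) + 2 * length (cnf_vars \<phi>)) \<and>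
    computes (\<lambda>d. enc (greedy_answer d)) prog
      (enc (formula_graph (poly P (length (cnf_vars \<phi>))) \<phi>, 2 * length (cnf_vars \<phi>))) t y \<and>
    (satisfiable \<phi> \<longleftrightarrow> length (datalist y) < poly P (length (cnf_vars \<phi>)))"
proof -
  from assms(2) obtain p where p: "\<And>n. g n \<le> poly p n" by (auto simp: poly_bounded_def)
  from assms(3) obtain q where q: "\<And>c I x Or. c \<ge> 1 \<Longrightarrow> is_instance IDS_vc I \<Longrightarrow> codes_instance IDS_vc x I \<Longrightarrow>
      approx_oracle IDS_vc c (g (parameter IDS_vc I)) Or \<Longrightarrow>
      \<exists>t y. t \<le> poly q (size x + parameter IDS_vc I) \<and>
        computes Or prog (input_code x (parameter IDS_vc I)) t y \<and> approx_solution IDS_vc (c * \<alpha>) I y"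
    unfolding approx_turing_kernelization_def by blast
  define A where "A = nat \<lceil>\<alpha>\<rceil>"
  have A: "\<alpha> \<le> real A" unfolding A_def by linarith
  \<comment> \<open>Chosen so that \<open>P n\<close> exceeds \<open>c * \<alpha> * (2 * n)\<close>
    for the ratio \<open>c = 1 + p (2 * n)\<close>; \<open>A\<close> is \<open>\<alpha>\<close>
    rounded up, and the final 1 makes the inequality strict.\<close>
  define P where "P = [:A:] * (1 + p \<circ>\<^sub>p [:0, 2:]) * [:0, 2:] + 1"
  have P: "poly P n = A * (1 + poly p (2 * n)) * (2 * n) + 1" for n
    by (simp add: P_def poly_pcompose mult.commute)
  show thesis
  proof (rule that)
    fix \<phi>
    let ?vs = "cnf_vars \<phi>"
    let ?T = "poly P (length ?vs)"
    let ?G = "reduction_graph ?vs (copies ?T \<phi>)"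
    let ?x = "formula_graph ?T \<phi>"
    \<comment> \<open>At least the size bound on the queries, and at least 1 as required of a
      ratio.\<close>
    define c where "c = real (1 + poly p (2 * length ?vs))"
    have param: "parameter IDS_vc ?G = 2 * length ?vs"
      using vertex_cover_number_reduction_graph[OF distinct_cnf_vars] by (simp add: IDS_vc_def)
    have "is_instance IDS_vc ?G" "codes_instance IDS_vc (enc ?x) ?G"
      using simple_reduction_graph codes_reduction_graph[OF distinct_cnf_vars]
      by (simp_all add: IDS_vc_def formula_graph_def)
    moreover have "real (g (2 * length ?vs)) \<le> c" "c \<ge> 1"
      using p[of "2 * length ?vs"] by (auto simp: c_def)
    moreover from this have "approx_oracle IDS_vc c (g (2 * length ?vs)) (\<lambda>d. enc (greedy_answer d))"
      by (rule greedy_answer_approx)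
    ultimately obtain t y where ty: "t \<le> poly q (size (enc ?x) + 2 * length ?vs)"
      "computes (\<lambda>d. enc (greedy_answer d)) prog (input_code (enc ?x) (2 * length ?vs)) t y"
      "approx_solution IDS_vc (c * \<alpha>) ?G y"
      using q[of c ?G "enc ?x"] unfolding param by blast
    have "c * \<alpha> * real (2 * length ?vs) \<le> c * real A * real (2 * length ?vs)"
      using A \<open>c \<ge> 1\<close> by (intro mult_right_mono mult_left_mono) auto
    also have "\<dots> < real ?T" by (simp add: P c_def algebra_simps)
    finally have "satisfiable \<phi> \<longleftrightarrow> length (datalist y) < ?T"
      using satisfiable_iff_approx_solution[OF ty(3)] \<open>c \<ge> 1\<close> assms(1) by simp
    moreover have "input_code (enc ?x) (2 * length ?vs) = enc (?x, 2 * length ?vs)"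
      by (simp add: input_code_def)
    ultimately show "\<exists>t y. t \<le> poly q (size (enc ?x) + 2 * length ?vs) \<and>
        computes (\<lambda>d. enc (greedy_answer d)) prog (enc (?x, 2 * length ?vs)) t y \<and>
        (satisfiable \<phi> \<longleftrightarrow> length (datalist y) < ?T)"
      using ty by metis
  qed
qed

theorem theorem5:
  assumes "\<exists>\<alpha>\<ge>1. has_polynomial_approx_turing_kernelization \<alpha> IDS_vc"
  shows "has_polynomial_turing_kernelization CNF_SAT_n"
proof -
  from assms obtain \<alpha> g prog where \<alpha>: "\<alpha> \<ge> 1" "poly_bounded g" "approx_turing_kernelization \<alpha> IDS_vc g prog"
    unfolding has_polynomial_approx_turing_kernelization_def by blast
  obtain P q where q: "\<And>\<phi>. \<exists>t y.
    t \<le> poly q (size (enc (formula_graph (poly P (length (cnf_vars \<phi>))) \<phi>)) + 2 * length (cnf_vars \<phi>)) \<and>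
    computes (\<lambda>d. enc (greedy_answer d)) prog
      (enc (formula_graph (poly P (length (cnf_vars \<phi>))) \<phi>, 2 * length (cnf_vars \<phi>))) t y \<and>
    (satisfiable \<phi> \<longleftrightarrow> length (datalist y) < poly P (length (cnf_vars \<phi>)))"
    by (rule kernelization_decides_satisfiability[OF \<alpha>]) (rule that)
  \<comment> \<open>The successor ensures \<open>0 < N\<close>, so that cell 0, with the input and
    output of \<open>prog\<close>, belongs to the simulated cells.\<close>
  define N where "N = Suc (com_bound prog)"
  define small where "small Ty = (length (datalist (snd Ty)) < fst Ty)" for Ty :: "nat \<times> data"
  have "polytime small" unfolding small_def by (intro polytime_intros)
  then obtain pS cS where pS: "implements N cS (poly pS) small" by (rule polytimeE) blast
  from polytime_greedy_answer obtain pd d where d: "implements (N + 1) d (poly pd) greedy_answer"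
    by (rule polytimeE) blast
  from polytime_reduce[of P] obtain pR where pR: "\<And>a. size (enc (reduce P a)) \<le> poly pR (size (enc a))"
    "\<And>b. \<exists>c. implements b c (poly pR) (reduce P)" by (rule polytimeE) blast
  then obtain cR where cR: "implements N cR (poly pR) (reduce P)" by blast
  \<comment> \<open>Cell \<open>N\<close> keeps the result of the reduction during the simulated
    run, so that the threshold is still there to be compared with the answer in cell 0.\<close>
  define main_yes where "main_yes = Seq (Assign 0 (Right (Right (Var N)))) (Seq (answer_queries N d prog)
    (Seq (Assign N (NodeE (Left (Right (Var N))) (Var 0))) (Seq cS (Assign 0 (Var N)))))"
  define main where "main = Seq (Assign N (Var 0)) (Seq cR (If (Left (Var N)) main_yes (Assign 0 LeafE)))"
  \<comment> \<open>The pair \<open>(x, k)\<close> has size \<open>n + 1\<close> for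
    \<open>n = size x + k\<close>; \<open>h\<close> bounds both the time and the output size of the
    reduction.\<close>
  define h where "h n = poly pR (n + 1)" for n
  \<comment> \<open>The outermost 1 is reserved for writing the output, a truth value of size at
    most 1.\<close>
  define time where "time n = (1 + (h n + (1 + (poly q (h n) * (poly pd (poly q (h n)) + 2) +
    (1 + (poly pS (h n + poly q (h n) + 1) + 1))) + 1))) + 1" for n
  have "poly_bounded time" unfolding time_def h_def by auto
  then obtain pt where pt: "\<And>n. time n \<le> poly pt n" by (auto simp: poly_bounded_def)
  have "\<exists>t\<le>poly pt (size x + k). computes Or main (input_code x k) t (bool_code ((x, k) \<in> CNF_SAT_n))"
    for x k Or
  proof -
    let ?n = "size x + k"
    define r where "r = reduce P (x, k)"
    have size_r: "size (enc r) \<le> h ?n" using pR(1)[of "(x, k)"] by (simp add: r_def h_def)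
    let ?s = "(\<lambda>_. Leaf)(0 := input_code x k)"
    let ?s1 = "?s(N := enc (x, k))"
    have 1: "runs Or (Assign N (Var 0)) ?s 1 ?s1"
      using runs_Assign[of Or N "Var 0" ?s] by (simp add: input_code_def)
    obtain s2 where s2: "runs Or cR ?s1 (h ?n) s2" "s2 N = enc r" "\<And>i. i < N \<Longrightarrow> s2 i = ?s1 i"
      using implementsE[OF cR, of ?s1 "(x, k)"] by (auto simp: h_def r_def)
    have "\<exists>s'. runs Or main ?s (time ?n - 1) s' \<and> s' 0 = bool_code ((x, k) \<in> CNF_SAT_n)"
    proof (cases "fst r")
      case False
      then have no: "(x, k) \<notin> CNF_SAT_n" by (auto simp: in_CNF_SAT_n_iff r_def reduce_def)
      have "runs Or (If (Left (Var N)) main_yes (Assign 0 LeafE)) s2 (1 + 1) (s2(0 := Leaf))"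
        using runs_IfFalse[OF _ runs_Assign[of Or 0 LeafE s2], of "Left (Var N)" main_yes] False s2(2)
        by (simp add: bool_code_def)
      from runs_mono[OF runs_Seq[OF 1 runs_Seq[OF s2(1) this]], of "time ?n - 1"]
      show ?thesis using no by (auto simp: main_def time_def bool_code_def)
    next
      case True
      define \<phi> where "\<phi> = parse_cnf x"
      define T where "T = poly P k"
      define G where "G = formula_graph T \<phi>"
      have valid: "valid_cnf x" "length (cnf_vars \<phi>) = k"
        using True by (auto simp: r_def reduce_def \<phi>_def)
      have r: "r = (True, T, G, 2 * k)"
        using valid by (simp add: r_def reduce_def \<phi>_def T_def G_def)
      from q[of \<phi>] obtain t y where ty: "t \<le> poly q (size (enc G) + 2 * k)"
        "computes (\<lambda>d. enc (greedy_answer d)) prog (enc (G, 2 * k)) t y"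
        "satisfiable \<phi> \<longleftrightarrow> length (datalist y) < T"
        unfolding valid(2) T_def[symmetric] G_def[symmetric] by blast
      have size_T_G: "size (enc T) \<le> h ?n" "size (enc G) + 2 * k \<le> h ?n"
        using size_r by (simp_all add: r)
      have t: "t \<le> poly q (h ?n)" using ty(1) poly_nat_monoD[OF size_T_G(2), of q] by linarith
      from ty(2) obtain t' s' where t': "exec (\<lambda>d. enc (greedy_answer d)) prog ((\<lambda>_. Leaf)(0 := enc (G, 2 * k))) t' s'"
        "y = s' 0" "t = t' + size y" unfolding computes_def by blast
      let ?s3 = "s2(0 := enc (G, 2 * k))"
      have 3: "runs Or (Assign 0 (Right (Right (Var N)))) s2 1 ?s3"
        using runs_Assign[of Or 0 "Right (Right (Var N))" s2] s2(2) by (simp add: r)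
      \<comment> \<open>The reduction ran at base \<open>N\<close> and left the cells below
        unchanged, so after the assignment to cell 0 they form the initial state that
        \<open>prog\<close> expects.\<close>
      have agree: "?s3 i = ((\<lambda>_. Leaf)(0 := enc (G, 2 * k))) i" if "i < N" for i
        using s2(3)[OF that] that by simp
      have "com_bound prog \<le> N" "t' \<le> poly q (h ?n)" using t t'(3) by (auto simp: N_def)
      then obtain s4 where s4: "runs Or (answer_queries N d prog) ?s3 (t' * (poly pd (poly q (h ?n)) + 2)) s4"
        "\<And>i. i < N \<Longrightarrow> s4 i = s' i" "s4 N = ?s3 N"
        using runs_answer_queries[OF d t'(1) _ _ agree, of "poly q (h ?n)" Or] by blast
      have s4': "s4 0 = y" "s4 N = enc r" using s4(2)[of 0] s4(3) s2(2) t'(2) by (auto simp: N_def)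
      let ?s5 = "s4(N := enc (T, y))"
      have 5: "runs Or (Assign N (NodeE (Left (Right (Var N))) (Var 0))) s4 1 ?s5"
        using runs_Assign[of Or N "NodeE (Left (Right (Var N))) (Var 0)" s4] s4' by (simp add: r)
      obtain s6 where s6: "runs Or cS ?s5 (poly pS (size (enc (T, y)))) s6" "s6 N = enc (small (T, y))"
        using implementsE[of N cS "poly pS" small ?s5 "(T, y)" Or, OF pS fun_upd_same] by blast
      have 7: "runs Or (Assign 0 (Var N)) s6 1 (s6(0 := enc (small (T, y))))"
        using runs_Assign[of Or 0 "Var N" s6] s6(2) by simp
      have le4: "t' * (poly pd (poly q (h ?n)) + 2) \<le> poly q (h ?n) * (poly pd (poly q (h ?n)) + 2)"
        using t t'(3) by (intro mult_right_mono) auto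
      have le6: "poly pS (size (enc (T, y))) \<le> poly pS (h ?n + poly q (h ?n) + 1)"
        using t t'(3) size_T_G(1) by (intro poly_nat_monoD) simp
      have "runs Or main_yes s2 (1 + (poly q (h ?n) * (poly pd (poly q (h ?n)) + 2) +
          (1 + (poly pS (h ?n + poly q (h ?n) + 1) + 1)))) (s6(0 := enc (small (T, y))))"
        unfolding main_yes_def
        by (rule runs_Seq[OF 3 runs_Seq[OF runs_mono[OF s4(1) le4] runs_Seq[OF 5
          runs_Seq[OF runs_mono[OF s6(1) le6] 7]]]])
      from runs_IfTrue[OF _ this, of "Left (Var N)"]
      have "runs Or (If (Left (Var N)) main_yes (Assign 0 LeafE)) s2 (1 + (poly q (h ?n) * (poly pd (poly q (h ?n)) + 2) +
          (1 + (poly pS (h ?n + poly q (h ?n) + 1) + 1))) + 1) (s6(0 := enc (small (T, y))))"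
        using s2(2) by (simp add: r bool_code_def)
      from runs_Seq[OF 1 runs_Seq[OF s2(1) this]]
      have "runs Or main ?s (time ?n - 1) (s6(0 := enc (small (T, y))))"
        unfolding main_def time_def by simp
      moreover have "(x, k) \<in> CNF_SAT_n \<longleftrightarrow> small (T, y)"
        using valid ty(3) by (simp add: in_CNF_SAT_n_iff small_def \<phi>_def)
      ultimately show ?thesis by auto
    qed
    then obtain t s' where "exec Or main ?s t s'" "t \<le> time ?n - 1" "s' 0 = bool_code ((x, k) \<in> CNF_SAT_n)"
      unfolding runs_def by blast
    moreover have "time ?n - 1 + 1 = time ?n" by (simp add: time_def)
    ultimately show ?thesis
      using pt[of ?n] size_bool_code[of "(x, k) \<in> CNF_SAT_n"]
      unfolding computes_def by (intro exI[of _ "t + size (bool_code ((x, k) \<in> CNF_SAT_n))"]) auto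
  qed
  \<comment> \<open>The bounds above hold for an arbitrary \<open>Or\<close>, so the size bound can
    be 0.\<close>
  then have "turing_kernelization CNF_SAT_n (\<lambda>_. 0) main"
    unfolding turing_kernelization_def by blast
  then show ?thesis
    unfolding has_polynomial_turing_kernelization_def by blast
qed

end
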